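(* Let $p$ be a prime. Suppose $G$ is a graph on $n$ vertices such that $p$ divides $e(G)$, the minimum degree of $G$ is at least $1$, and there exists a $2$-packing $S$ of $G$ with $|S|=p-1$. Let $$s_0=\left|\{v\in S:\deg(v)\equiv 0 \pmod p\}\right|,$$ and let $c=0$ if $V(G)\neq \bigcup_{v\in S}N[v]$ or $\deg(v)=1$ for all $v\in S$, and $c=1$ otherwise. Then $$R(G,\mathbb{Z}_p)\leq \begin{cases} n+p-1+c & \text{if } s_0=0,\\ n+5p-9+s_0+c & \text{if } s_0\neq 0.\end{cases}$$ Moreover, in the case $s_0=c=0$, equality $R(G,\mathbb{Z}_p)=n+p-1$ holds if there exists an integer $d\not\equiv 0\pmod p$ such that $\deg(v)\equiv d\pmod p$ for all $v\in V(G)$.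
   Context: For a vertex $u$, $N[u]=N(u)\cup\{u\}$ is its closed neighborhood. A $2$-packing of a graph $G$ is a set $S\subseteq V(G)$ such that $N[u]\cap N[v]=\emptyset$ for all distinct $u,v\in S$. For a positive integer $k$ and a graph $G$, the $\mathbb{Z}_k$-Ramsey number $R(G,\mathbb{Z}_k)$ is the least $N$ (if it exists) such that every coloring $f:E(K_N)\to\mathbb{Z}_k$ contains a copy $G'$ of $G$ with $\sum_{e\in E(G')}f(e)=0$ (a zero-sum copy). It exists if and only if $k$ divides $e(G)$. *)

theory Defs
  imports
    "HOL-Library.Ramsey"
    "HOL-Library.Extended_Nat"
    "HOL-Number_Theory.Number_Theory"
begin

text \<open>A finite simple graph is given by its vertex set and its set of edges, each edge being
  a two-element set of vertices.\<close>

definition simple_graph :: "'a set \<Rightarrow> 'a set set \<Rightarrow> bool" where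
  "simple_graph V E \<longleftrightarrow> finite V \<and> E \<subseteq> [V]\<^bsup>2\<^esup>"

definition nbhd :: "'a set set \<Rightarrow> 'a \<Rightarrow> 'a set" where
  "nbhd E u = {v. {u, v} \<in> E}"

definition closed_nbhd :: "'a set set \<Rightarrow> 'a \<Rightarrow> 'a set" where
  "closed_nbhd E u = insert u (nbhd E u)"

definition vertex_degree :: "'a set set \<Rightarrow> 'a \<Rightarrow> nat" where
  "vertex_degree E u = card (nbhd E u)"

text \<open>Meaningful only for a finite nonempty vertex set.\<close>

definition min_degree :: "'a set \<Rightarrow> 'a set set \<Rightarrow> nat" where
  "min_degree V E = Min (vertex_degree E ` V)"

definition two_packing :: "'a set \<Rightarrow> 'a set set \<Rightarrow> 'a set \<Rightarrow> bool" where
  "two_packing V E S \<longleftrightarrow>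
     S \<subseteq> V \<and> (\<forall>u\<in>S. \<forall>v\<in>S. u \<noteq> v \<longrightarrow> closed_nbhd E u \<inter> closed_nbhd E v = {})"

text \<open>The complete graph on \<open>N\<close> vertices has vertex set \<open>{..<N}\<close> and edge set \<open>[{..<N}]\<^bsup>2\<^esup>\<close>.
  A copy of a graph in it is the image of that graph under an injective map of its vertices
  into \<open>{..<N}\<close>. This predicate holds of the edge set of a copy.\<close>

definition copy_edges :: "'a set \<Rightarrow> 'a set set \<Rightarrow> nat \<Rightarrow> nat set set \<Rightarrow> bool" where
  "copy_edges V E N E' \<longleftrightarrow> (\<exists>\<phi>. inj_on \<phi> V \<and> \<phi> ` V \<subseteq> {..<N} \<and> E' = (\<lambda>e. \<phi> ` e) ` E)"

text \<open>Elements of the cyclic group of order \<open>k\<close> are represented by the residues \<open>0, \<dots>, k - 1\<close>.\<close>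

definition forces_zero_sum_copy :: "'a set \<Rightarrow> 'a set set \<Rightarrow> nat \<Rightarrow> nat \<Rightarrow> bool" where
  "forces_zero_sum_copy V E k N \<longleftrightarrow>
     (\<forall>f :: nat set \<Rightarrow> int. f \<in> [{..<N}]\<^bsup>2\<^esup> \<rightarrow> {0..<int k} \<longrightarrow>
        (\<exists>E'. copy_edges V E N E' \<and> [(\<Sum>e\<in>E'. f e) = 0] (mod int k)))"

text \<open>The infimum of the empty set is \<open>\<infinity>\<close>, so the value is \<open>\<infinity>\<close> exactly when no suitable \<open>N\<close>
  exists, and an upper bound by a natural number includes existence.\<close>

definition zero_sum_ramsey :: "'a set \<Rightarrow> 'a set set \<Rightarrow> nat \<Rightarrow> enat" where
  "zero_sum_ramsey V E k = Inf (enat ` {N. forces_zero_sum_copy V E k N})"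

end

theory Submission
  imports Defs
begin

text \<open>Place the centres \<open>v \<in> S\<close> of a copy of the graph so that each of them can be moved between two
  points \<open>x\<close>, \<open>y\<close> without moving anything else, the sum over the edges at \<open>v\<close> being different in the two
  positions. As the closed neighbourhoods are disjoint, these \<open>p - 1\<close> moves are independent, and by
  Cauchy--Davenport some choice of positions makes the sum vanish. Such a position of \<open>v\<close> is available in
  every set of \<open>deg v + 2\<close> vertices of the host whose weighted degrees are not all equal, a gadget.

  If all degrees in \<open>S\<close> are nonzero modulo \<open>p\<close>, take as many disjoint gadgets as possible, small degrees
  first. If fewer than \<open>p - 1\<close> fit, the remaining vertices span a single colour \<open>b\<close>, and an exchange
  argument bounds every matching of edges of other colours by the number of gadgets. A maximum matching
  of this kind has fewer than \<open>p - 1\<close> edges, so that a copy with all edges of colour \<open>b\<close> exists: members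
  of \<open>S\<close> occupy one end of each matching edge, the other ends are left out.

  In general, \<open>p - 1\<close> disjoint alternating 4-cycles of nonzero weight extend to gadgets. If there are
  fewer, then outside of them the colouring has the form \<open>f {x, y} = h x + h y + \<kappa>\<close>, and a weighted
  Erdos--Ginzburg--Ziv theorem for the degree sequence yields a zero-sum copy.\<close>

section \<open>The Cauchy--Davenport theorem\<close>

text \<open>The constants come from counting. A gadget has one point more than the closed
  neighbourhood that it hosts, so \<open>p - 1\<close> gadgets and the other vertices need
  \<open>n + p - 1\<close> points. To see that a rest without a gadget for degree \<open>d\<close>
  has a single colour, \<open>d + 3\<close> points are compared: two centres and the
  \<open>d\<close>-subsets of a set of \<open>d + 1\<close> others. If \<open>S\<close> dominates
  the graph, only \<open>d + 2\<close> are sure to be left, whence \<open>c = 1\<close>; for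
  \<open>d = 1\<close> three points already suffice.

  The obstacle is a degree \<open>d\<close> divisible by \<open>p\<close>. If
  \<open>f {x, y} = h x + h y + \<kappa>\<close>, the weighted degree of \<open>x\<close> in a set
  of \<open>d + 2\<close> points is \<open>d * h x\<close> plus a term independent of
  \<open>x\<close>, so such a colouring has no gadget for \<open>d\<close>, however far it is from
  constant. Hence the second bound works with alternating 4-cycles of nonzero weight, which exactly
  the additive colourings lack. At most \<open>p - 2\<close> disjoint ones take
  \<open>4 * (p - 2)\<close> of \<open>n + 5 * p - 8\<close> points and leave \<open>n + p\<close>,
  enough for the weighted theorem.\<close>

lemma shift_mod_inj_on: "inj_on (\<lambda>a. (a + t) mod m) {0..<m}" for t m :: int
proof (rule inj_onI)
  fix x y assume xy: "x \<in> {0..<m}" "y \<in> {0..<m}" "(x + t) mod m = (y + t) mod m"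
  then have "[x + t = y + t] (mod m)" by (simp add: cong_def)
  then have "[x = y] (mod m)" by (simp add: cong_add_rcancel)
  then show "x = y" using xy by (simp add: cong_def)
qed

text \<open>Since \<open>t\<close> is invertible modulo the prime \<open>p\<close>, repeated shifts
  by \<open>t\<close> lead from any residue to any other.\<close>

lemma shift_closed_residues:
  fixes p :: nat and A :: "int set"
  assumes p: "prime p" and A: "A \<subseteq> {0..<int p}" "A \<noteq> {}"
    and t: "\<not> [t = 0] (mod int p)"
    and closed: "\<And>a. a \<in> A \<Longrightarrow> (a + t) mod int p \<in> A"
  shows "A = {0..<int p}"
proof
  obtain a where a: "a \<in> A" using A by auto
  have iter: "(a + int k * t) mod int p \<in> A" for k :: nat
  proof (induction k)
    case 0
    then show ?case using a A by auto
  next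
    case (Suc k)
    have "((a + int k * t) mod int p + t) mod int p \<in> A" using closed[OF Suc] .
    then show ?case by (simp add: mod_simps algebra_simps)
  qed
  have "coprime t (int p)"
  proof -
    have "\<not> int p dvd t" using t by (simp add: cong_0_iff)
    then show ?thesis using p
      by (metis coprime_commute prime_imp_coprime prime_nat_int_transfer)
  qed
  then obtain u where u: "[t * u = 1] (mod int p)" using cong_solve_coprime_int by blast
  show "{0..<int p} \<subseteq> A"
  proof
    fix b assume b: "b \<in> {0..<int p}"
    \<comment> \<open>The number of shifts that lead from \<open>a\<close> to \<open>b\<close>;
      \<open>u\<close> is the inverse of \<open>t\<close> modulo \<open>p\<close>.\<close>
    define k where "k = nat (((b - a) * u) mod int p)"
    have p0: "int p > 0" using p by (simp add: prime_gt_0_nat)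
    have k: "int k = ((b - a) * u) mod int p" unfolding k_def using p0 by simp
    have "[a + int k * t = a + ((b - a) * u) * t] (mod int p)"
      unfolding k by (intro cong_add cong_mult cong_refl) (simp add: cong_def)
    also have "a + ((b - a) * u) * t = a + (b - a) * (t * u)" by (simp add: algebra_simps)
    also have "[a + (b - a) * (t * u) = a + (b - a) * 1] (mod int p)"
      by (intro cong_add cong_mult cong_refl u)
    also have "a + (b - a) * 1 = b" by simp
    finally have "(a + int k * t) mod int p = b" using b by (simp add: cong_def)
    then show "b \<in> A" using iter[of k] by simp
  qed
qed (use A in auto)

definition sumset_mod :: "nat \<Rightarrow> int set \<Rightarrow> int set \<Rightarrow> int set" where
  "sumset_mod p A B = (\<lambda>(a, b). (a + b) mod int p) ` (A \<times> B)"

lemma sumset_modI: "a \<in> A \<Longrightarrow> b \<in> B \<Longrightarrow> (a + b) mod int p \<in> sumset_mod p A B"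
  unfolding sumset_mod_def by (rule image_eqI[of _ _ "(a, b)"]) auto

text \<open>Induction with the Dyson transform. If some difference \<open>b1 - b2\<close> does not
  map \<open>A\<close> into itself, a translate of \<open>B\<close> meets \<open>A\<close> without
  lying inside it. The elements of \<open>B\<close> whose translates miss \<open>A\<close> leave
  \<open>B\<close>, and their translates join \<open>A\<close>. This keeps
  \<open>card A + card B\<close>, adds nothing to the sumset and shrinks \<open>B\<close>. If the
  difference does preserve \<open>A\<close>, then \<open>A\<close> consists of all residues.\<close>

lemma cauchy_davenport:
  fixes p :: nat
  assumes p: "prime p" and "A \<subseteq> {0..<int p}" "A \<noteq> {}" "B \<subseteq> {0..<int p}" "B \<noteq> {}"
  shows "card (sumset_mod p A B) \<ge> min p (card A + card B - 1)"
  using assms(2-)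
proof (induction "card B" arbitrary: A B rule: less_induct)
  case less
  note fin = finite_subset[OF _ finite_atLeastLessThan_int]
  have fA: "finite A" and fB: "finite B" using less.prems fin by blast+
  have fS: "finite (sumset_mod p A B)" unfolding sumset_mod_def using fA fB by simp
  obtain b2 where b2: "b2 \<in> B" using less.prems by auto
  have low: "card A \<le> card (sumset_mod p A B)"
  proof (rule card_inj_on_le[where f = "\<lambda>a. (a + b2) mod int p"])
    show "inj_on (\<lambda>a. (a + b2) mod int p) A"
      using shift_mod_inj_on less.prems(1) inj_on_subset by blast
    show "(\<lambda>a. (a + b2) mod int p) ` A \<subseteq> sumset_mod p A B" using b2 sumset_modI by blast
  qed (rule fS)
  show ?case
  proof (cases "B = {b2}")
    case True
    then show ?thesis using low by simp
  next
    case False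
    then obtain b1 where b1: "b1 \<in> B" "b1 \<noteq> b2" using b2 by blast
    have t: "\<not> [b1 - b2 = 0] (mod int p)"
    proof
      assume "[b1 - b2 = 0] (mod int p)"
      then have "[b1 = b2] (mod int p)" by (simp add: cong_diff_iff_cong_0)
      moreover have "b1 \<in> {0..<int p}" "b2 \<in> {0..<int p}" using b1 b2 less.prems(3) by blast+
      ultimately show False using b1(2) by (auto simp: cong_def)
    qed
    show ?thesis
    proof (cases "\<forall>a\<in>A. (a + (b1 - b2)) mod int p \<in> A")
      case True
      then have "A = {0..<int p}" using shift_closed_residues[OF p less.prems(1,2) t] by blast
      then have "card A = p" by simp
      then show ?thesis using low by simp
    next
      case False
      then obtain a where a: "a \<in> A" "(a + (b1 - b2)) mod int p \<notin> A" by blast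
      \<comment> \<open>With this shift \<open>sh b2\<close> is \<open>a\<close>, so
        \<open>b2\<close> stays in \<open>B'\<close>, while \<open>sh b1\<close> is
        \<open>a + (b1 - b2)\<close>, outside \<open>A\<close>, so \<open>b1\<close> leaves.\<close>
      define e where "e = a - b2"
      define sh where "sh b = (b + e) mod int p" for b
      define B' where "B' = {b \<in> B. sh b \<in> A}"
      define A' where "A' = A \<union> sh ` (B - B')"
      have p0: "int p > 0" using p by (simp add: prime_gt_0_nat)
      have b2B': "b2 \<in> B'" unfolding B'_def sh_def e_def using b2 a(1) less.prems(1) by auto
      have b1B': "b1 \<notin> B'" unfolding B'_def sh_def e_def using a(2) by (simp add: algebra_simps)
      have "B' \<subset> B" using b1 b1B' unfolding B'_def by blast
      then have lt: "card B' < card B" using fB psubset_card_mono by blast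
      have A'sub: "A' \<subseteq> {0..<int p}" unfolding A'_def sh_def using less.prems(1) p0 by auto
      have IH: "min p (card A' + card B' - 1) \<le> card (sumset_mod p A' B')"
        by (rule less.hyps[OF lt A'sub]) (use b2B' less.prems in \<open>auto simp: A'_def B'_def\<close>)
      have "inj_on sh (B - B')" unfolding sh_def
        using shift_mod_inj_on less.prems(3) inj_on_subset by (metis Diff_subset)
      then have "card (sh ` (B - B')) = card B - card B'"
        using fB \<open>B' \<subset> B\<close> by (simp add: card_image card_Diff_subset finite_subset[of B' B] psubset_imp_subset)
      moreover have "A \<inter> sh ` (B - B') = {}" unfolding B'_def by auto
      ultimately have "card A' = card A + (card B - card B')"
        unfolding A'_def using fA fB by (simp add: card_Un_disjoint)
      then have eq: "card A' + card B' = card A + card B" using lt by simp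
      have "sumset_mod p A' B' \<subseteq> sumset_mod p A B"
      proof
        fix s assume "s \<in> sumset_mod p A' B'"
        then obtain x y where xy: "x \<in> A'" "y \<in> B'" "s = (x + y) mod int p"
          unfolding sumset_mod_def by auto
        have yB: "y \<in> B" "sh y \<in> A" using xy(2) unfolding B'_def by auto
        show "s \<in> sumset_mod p A B"
        proof (cases "x \<in> A")
          case True
          then show ?thesis using xy(3) yB sumset_modI by blast
        next
          case False
          then obtain b where b: "b \<in> B" "x = sh b" using xy(1) unfolding A'_def by auto
          \<comment> \<open>The translation by \<open>e\<close> passes from one summand to the
            other: in \<open>b + e + y\<close> the part \<open>y + e\<close> lies in
            \<open>A\<close> modulo \<open>p\<close>.\<close>
          have "s = (sh y + b) mod int p" unfolding xy(3) b(2) sh_def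
            by (simp add: mod_simps algebra_simps)
          then show ?thesis using sumset_modI[OF yB(2) b(1)] by simp
        qed
      qed
      then have "card (sumset_mod p A' B') \<le> card (sumset_mod p A B)" using fS card_mono by blast
      then show ?thesis using IH eq by simp
    qed
  qed
qed

text \<open>Cauchy--Davenport iterated: each further set \<open>A i\<close> adds
  \<open>card (A i) - 1\<close> residues until all \<open>p\<close> are reached. With sets of two
  elements, \<open>p - 1\<close> of them suffice; this explains the size of
  \<open>S\<close>.\<close>

lemma card_choice_sums:
  fixes p :: nat and A :: "'i \<Rightarrow> int set"
  assumes p: "prime p" and "finite I" and "\<And>i. i \<in> I \<Longrightarrow> A i \<subseteq> {0..<int p} \<and> A i \<noteq> {}"
  shows "card ((\<lambda>c. (\<Sum>i\<in>I. c i) mod int p) ` Pi I A) \<ge> min p (1 + (\<Sum>i\<in>I. card (A i) - 1))"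
  using assms(2,3)
proof (induction I rule: finite_induct)
  case empty
  then show ?case using prime_gt_0_nat[OF p] by simp
next
  case (insert j I)
  let ?T = "\<lambda>I. (\<lambda>c. (\<Sum>i\<in>I. c i) mod int p) ` Pi I A"
  have p0: "int p > 0" using p by (simp add: prime_gt_0_nat)
  have Tsub: "?T I \<subseteq> {0..<int p}" for I using p0 by auto
  have ne: "?T I \<noteq> {}"
  proof -
    have "(\<lambda>i. SOME a. a \<in> A i) \<in> Pi I A" using insert.prems by (auto simp: some_in_eq)
    then show ?thesis by blast
  qed
  have Aj: "A j \<subseteq> {0..<int p}" "A j \<noteq> {}" using insert.prems by auto
  have cA: "card (A j) > 0" using Aj by (meson card_gt_0_iff finite_atLeastLessThan_int finite_subset)
  have "sumset_mod p (?T I) (A j) \<subseteq> ?T (insert j I)"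
  proof
    fix s assume "s \<in> sumset_mod p (?T I) (A j)"
    then obtain c a where c: "c \<in> Pi I A" "a \<in> A j"
      and s: "s = ((\<Sum>i\<in>I. c i) mod int p + a) mod int p"
      unfolding sumset_mod_def by auto
    have "c(j := a) \<in> Pi (insert j I) A" using c insert.hyps by auto
    moreover have "(\<Sum>i\<in>insert j I. (c(j := a)) i) = a + (\<Sum>i\<in>I. c i)"
      using insert.hyps by (simp add: sum.insert_remove) (rule sum.cong, auto)
    then have "s = (\<Sum>i\<in>insert j I. (c(j := a)) i) mod int p"
      unfolding s by (simp only: mod_simps add.commute)
    ultimately show "s \<in> ?T (insert j I)" by blast
  qed
  then have "card (sumset_mod p (?T I) (A j)) \<le> card (?T (insert j I))"
    using Tsub by (meson card_mono finite_atLeastLessThan_int finite_subset)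
  moreover have "min p (card (?T I) + card (A j) - 1) \<le> card (sumset_mod p (?T I) (A j))"
    by (rule cauchy_davenport[OF p Tsub ne Aj])
  moreover have "min p (1 + (\<Sum>i\<in>I. card (A i) - 1)) \<le> card (?T I)"
    using insert by auto
  ultimately show ?case using insert.hyps cA by auto
qed

lemma choice_sum_cong:
  fixes p :: nat and A :: "'i \<Rightarrow> int set" and t :: int
  assumes p: "prime p" and "finite I" and "\<And>i. i \<in> I \<Longrightarrow> A i \<subseteq> {0..<int p} \<and> A i \<noteq> {}"
    and "(\<Sum>i\<in>I. card (A i) - 1) \<ge> p - 1"
  obtains c where "\<And>i. i \<in> I \<Longrightarrow> c i \<in> A i" "[(\<Sum>i\<in>I. c i) = t] (mod int p)"
proof -
  let ?T = "(\<lambda>c. (\<Sum>i\<in>I. c i) mod int p) ` Pi I A"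
  have p0: "int p > 0" using p by (simp add: prime_gt_0_nat)
  have "min p (1 + (\<Sum>i\<in>I. card (A i) - 1)) \<le> card ?T"
    by (rule card_choice_sums[OF p \<open>finite I\<close>]) (rule assms(3))
  moreover have "min p (1 + (\<Sum>i\<in>I. card (A i) - 1)) = p" using assms(4) by linarith
  moreover have "card {0..<int p} = p" by simp
  ultimately have "card {0..<int p} \<le> card ?T" by metis
  moreover have "?T \<subseteq> {0..<int p}" using p0 by auto
  ultimately have T: "?T = {0..<int p}" by (intro card_seteq finite_atLeastLessThan_int)
  have "t mod int p \<in> ?T" unfolding T using p0 by simp
  then obtain c where "c \<in> Pi I A" "t mod int p = (\<Sum>i\<in>I. c i) mod int p" by (rule imageE)
  then show thesis using that by (auto simp: cong_def)
qed

section \<open>Gadgets\<close>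

text \<open>The bound is imposed on every set and not just on pairs, so that colours congruent
  modulo \<open>p\<close> are equal without any membership condition.\<close>

locale residue_colouring =
  fixes p :: nat and f :: "'b set \<Rightarrow> int"
  assumes prime_p: "prime p" and range: "f e \<in> {0..<int p}"
begin

definition weighted_degree :: "'b set \<Rightarrow> 'b \<Rightarrow> int" where
  "weighted_degree X x = (\<Sum>a\<in>X - {x}. f {x, a})"

text \<open>In a gadget, a vertex of degree \<open>d\<close> can be placed at either of two points \<open>x\<close>, \<open>y\<close>, with its
  neighbours at the other \<open>d\<close> points, and the two placements give different sums. The edge \<open>{x, y}\<close>
  occurs in both weighted degrees, hence does not matter.\<close>

definition gadget :: "nat \<Rightarrow> 'b set \<Rightarrow> bool" where
  "gadget d X \<longleftrightarrow> card X = d + 2 \<and>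
     (\<exists>x\<in>X. \<exists>y\<in>X. \<not> [weighted_degree X x = weighted_degree X y] (mod int p))"

definition monochromatic :: "int \<Rightarrow> 'b set \<Rightarrow> bool" where
  "monochromatic b X \<longleftrightarrow> (\<forall>x\<in>X. \<forall>y\<in>X. x \<noteq> y \<longrightarrow> f {x, y} = b)"

lemma colour_eqI: "[f e = f e'] (mod int p) \<Longrightarrow> f e = f e'"
  using range[of e] range[of e'] by (simp add: cong_def)

lemma prime_int_p: "prime (int p)"
  using prime_p by simp

lemma cong_mult_nat_0:
  assumes "\<not> p dvd d" "[int d * t = 0] (mod int p)"
  shows "[t = 0] (mod int p)"
  using assms prime_int_p by (auto simp: cong_0_iff prime_dvd_mult_iff)

lemma gadget_card: "gadget d X \<Longrightarrow> card X = d + 2"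
  by (simp add: gadget_def)

lemma gadget_finite: "gadget d X \<Longrightarrow> finite X"
  by (metis gadget_card card.infinite add_is_0 zero_neq_numeral)

lemma monochromatic_subset: "monochromatic b X \<Longrightarrow> Y \<subseteq> X \<Longrightarrow> monochromatic b Y"
  unfolding monochromatic_def by blast

lemma monochromaticD: "monochromatic b X \<Longrightarrow> x \<in> X \<Longrightarrow> y \<in> X \<Longrightarrow> x \<noteq> y \<Longrightarrow> f {x, y} = b"
  unfolding monochromatic_def by blast

lemma monochromatic_weighted_degree:
  assumes "monochromatic b X" "x \<in> X" "finite X"
  shows "weighted_degree X x = int (card X - 1) * b"
proof -
  have "weighted_degree X x = (\<Sum>a\<in>X - {x}. b)" unfolding weighted_degree_def
    by (rule sum.cong) (use assms in \<open>auto intro: monochromaticD\<close>)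
  then show ?thesis using assms by simp
qed

lemma monochromatic_not_gadget: "monochromatic b X \<Longrightarrow> \<not> gadget d X"
  using gadget_finite[of d X] monochromatic_weighted_degree[of b X] unfolding gadget_def
  by (metis cong_refl)

lemma gadgetI:
  assumes "finite A" "card A = d" "x \<notin> A" "y \<notin> A" "x \<noteq> y"
    and "\<not> [(\<Sum>a\<in>A. f {x, a}) = (\<Sum>a\<in>A. f {y, a})] (mod int p)"
  shows "gadget d (insert x (insert y A))"
proof -
  let ?X = "insert x (insert y A)"
  have "?X - {x} = insert y A" "?X - {y} = insert x A" using assms by auto
  then have "weighted_degree ?X x = f {x, y} + (\<Sum>a\<in>A. f {x, a})"
    "weighted_degree ?X y = f {x, y} + (\<Sum>a\<in>A. f {y, a})"
    unfolding weighted_degree_def using assms by (simp_all add: insert_commute)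
  then have "\<not> [weighted_degree ?X x = weighted_degree ?X y] (mod int p)"
    using assms(6) by (simp add: cong_add_lcancel)
  moreover have "card ?X = d + 2" using assms by simp
  ultimately show ?thesis unfolding gadget_def by blast
qed

lemma gadgetE:
  assumes "gadget d X"
  obtains x y A where "X = insert x (insert y A)" "finite A" "card A = d" "x \<notin> A" "y \<notin> A" "x \<noteq> y"
    "\<not> [(\<Sum>a\<in>A. f {x, a}) = (\<Sum>a\<in>A. f {y, a})] (mod int p)"
proof -
  obtain x y where xy: "x \<in> X" "y \<in> X"
    and ne: "\<not> [weighted_degree X x = weighted_degree X y] (mod int p)"
    using assms unfolding gadget_def by blast
  have fX: "finite X" using assms by (rule gadget_finite)
  have xney: "x \<noteq> y" using ne cong_refl by metis
  define A where "A = X - {x, y}"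
  have A: "finite A" "x \<notin> A" "y \<notin> A" unfolding A_def using fX by auto
  have X: "X = insert x (insert y A)" unfolding A_def using xy by auto
  have "X - {x} = insert y A" "X - {y} = insert x A" unfolding A_def using xy xney by auto
  then have "weighted_degree X x = f {x, y} + (\<Sum>a\<in>A. f {x, a})"
    "weighted_degree X y = f {x, y} + (\<Sum>a\<in>A. f {y, a})"
    unfolding weighted_degree_def using A by (simp_all add: insert_commute)
  then have 1: "\<not> [(\<Sum>a\<in>A. f {x, a}) = (\<Sum>a\<in>A. f {y, a})] (mod int p)"
    using ne by (simp add: cong_add_lcancel)
  have 2: "card A = d" using gadget_card[OF assms] A xney unfolding X by simp
  show thesis by (rule that[OF X A(1) 2 A(2,3) xney 1])
qed

text \<open>Any two edges are joined by a chain in which consecutive edges share an end. The case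
  \<open>y = x0\<close> is separate because \<open>{x0, y}\<close> is then no edge.\<close>

lemma monochromaticI_stars:
  assumes "x0 \<in> Y" "y0 \<in> Y" "x0 \<noteq> y0"
    and star: "\<And>x y v. x \<in> Y \<Longrightarrow> y \<in> Y \<Longrightarrow> v \<in> Y \<Longrightarrow> x \<noteq> v \<Longrightarrow> y \<noteq> v \<Longrightarrow> f {x, v} = f {y, v}"
  shows "monochromatic (f {x0, y0}) Y"
  unfolding monochromatic_def
proof (intro ballI impI)
  fix x y assume xy: "x \<in> Y" "y \<in> Y" "x \<noteq> y"
  show "f {x, y} = f {x0, y0}"
  proof (cases "y = x0")
    case True
    then have "f {x, x0} = f {y0, x0}" using star[OF xy(1) assms(2,1)] xy(3) assms(3) by metis
    then show ?thesis unfolding True by (simp only: insert_commute)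
  next
    case False
    then have "f {x, y} = f {x0, y}" using star[OF xy(1) assms(1) xy(2)] xy(3) by metis
    also have "\<dots> = f {y, x0}" by (simp only: insert_commute)
    also have "\<dots> = f {y0, x0}" using star[OF xy(2) assms(2,1)] False assms(3) by metis
    finally show ?thesis by (simp only: insert_commute)
  qed
qed

text \<open>For fixed \<open>x\<close>, \<open>y\<close> let
  \<open>g a = f {x, a} - f {y, a}\<close>. Without gadgets, \<open>g\<close> sums to zero over
  every \<open>d\<close>-set off \<open>x\<close>, \<open>y\<close>. Inside a set \<open>A\<close>
  of \<open>d + 1\<close> points this makes every \<open>g a\<close> congruent to the total
  \<open>sum g A\<close>; adding up, \<open>d * sum g A\<close> vanishes, hence so does
  \<open>sum g A\<close>, as \<open>p\<close> does not divide \<open>d\<close>. So edges at a common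
  vertex agree. For \<open>d = 1\<close> the set \<open>{v}\<close> is itself a
  \<open>d\<close>-set, and no further points are needed.\<close>

lemma monochromatic_if_no_gadget:
  assumes fin: "finite Y" and d: "\<not> p dvd d"
    and big: "card Y \<ge> d + 3 \<or> d = 1 \<and> card Y \<ge> 3"
    and none: "\<And>X. X \<subseteq> Y \<Longrightarrow> \<not> gadget d X"
  obtains b where "monochromatic b Y"
proof -
  have d1: "d \<ge> 1" using d by (cases d) auto
  have star: "f {x, v} = f {y, v}" if xyv: "x \<in> Y" "y \<in> Y" "v \<in> Y" "x \<noteq> v" "y \<noteq> v" for x y v
  proof (cases "x = y")
    case False
    have balanced: "[(\<Sum>a\<in>A. f {x, a}) = (\<Sum>a\<in>A. f {y, a})] (mod int p)"
      if "A \<subseteq> Y - {x, y}" "card A = d" for A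
    proof (rule ccontr)
      assume neq: "\<not> ?thesis"
      have "finite A" "x \<notin> A" "y \<notin> A" using that fin finite_subset[of A Y] by auto
      then have "gadget d (insert x (insert y A))" using gadgetI that(2) False neq by blast
      moreover have "insert x (insert y A) \<subseteq> Y" using that xyv by blast
      ultimately show False using none by blast
    qed
    show ?thesis
    proof (cases "card Y \<ge> d + 3")
      case False
      then have "d = 1" using big by blast
      then have "[f {x, v} = f {y, v}] (mod int p)" using balanced[of "{v}"] xyv by simp
      then show ?thesis by (rule colour_eqI)
    next
      case True
      have "card (Y - {x, y, v}) = card Y - 3" using xyv False fin by (simp add: card_Diff_subset)
      then have "d \<le> card (Y - {x, y, v})" using True by simp
      then obtain W where W: "W \<subseteq> Y - {x, y, v}" "card W = d" "finite W"
        using obtain_subset_with_card_n by blast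
      define A where "A = insert v W"
      define g where "g a = f {x, a} - f {y, a}" for a
      have "v \<notin> W" using W by blast
      then have A: "finite A" "card A = d + 1" "A \<subseteq> Y - {x, y}" unfolding A_def using W xyv by auto
      have ga: "[g a = sum g A] (mod int p)" if a: "a \<in> A" for a
      proof -
        have "A - {a} \<subseteq> Y - {x, y}" "card (A - {a}) = d" using A a by auto
        from balanced[OF this] have "[(\<Sum>a\<in>A - {a}. g a) = 0] (mod int p)"
          unfolding g_def sum_subtractf by (simp add: cong_diff_iff_cong_0)
        moreover have "sum g A = g a + (\<Sum>a\<in>A - {a}. g a)" using A a by (simp add: sum.remove)
        ultimately show ?thesis using cong_add[OF cong_refl[of "g a"]] by (metis add.right_neutral cong_sym)
      qed
      have "[sum g A = (\<Sum>a\<in>A. sum g A)] (mod int p)" by (rule cong_sum) (rule ga)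
      then have "[sum g A + 0 = sum g A + int d * sum g A] (mod int p)"
        using A by (simp add: algebra_simps)
      then have "[int d * sum g A = 0] (mod int p)" using cong_add_lcancel cong_sym by blast
      then have "[sum g A = 0] (mod int p)" by (rule cong_mult_nat_0[OF d])
      then have "[g v = 0] (mod int p)" using ga[of v] cong_trans unfolding A_def by blast
      then have "[f {x, v} = f {y, v}] (mod int p)" unfolding g_def by (simp add: cong_diff_iff_cong_0)
      then show ?thesis by (rule colour_eqI)
    qed
  qed auto
  have "card Y \<ge> 2" using big by linarith
  then obtain x0 y0 where "x0 \<in> Y" "y0 \<in> Y" "x0 \<noteq> y0"
    by (metis card_le_Suc0_iff_eq fin not_less_eq_eq numeral_2_eq_2)
  then show thesis using that monochromaticI_stars star by blast
qed

text \<open>Suppose that all weighted degrees agree. Comparing \<open>w\<close> with a point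
  \<open>x\<close> of \<open>D\<close> gives \<open>f {u, x} = f {u, w}\<close>. Then comparing
  \<open>u\<close> with \<open>w\<close> gives \<open>d * f {u, w} = d * b\<close> modulo
  \<open>p\<close>, which is impossible since \<open>d\<close> can be cancelled.\<close>

lemma gadget_from_edge_one_sided:
  assumes R: "finite R" "monochromatic b R" and uw: "u \<noteq> w" "f {u, w} \<noteq> b" and d: "\<not> p dvd d"
    and D: "D \<subseteq> R - {u, w}" "card D = d" and w: "\<And>x. x \<in> D \<Longrightarrow> f {w, x} = b"
    and b: "b \<in> {0..<int p}"
  shows "gadget d ({u, w} \<union> D)"
proof (rule ccontr)
  let ?X = "{u, w} \<union> D"
  assume no: "\<not> gadget d ?X"
  have fD: "finite D" using D R finite_subset by blast
  have uwD: "u \<notin> D" "w \<notin> D" using D by auto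
  have card: "card ?X = d + 2" using fD uwD uw D by simp
  have reg: "[weighted_degree ?X x = weighted_degree ?X y] (mod int p)"
    if "x \<in> ?X" "y \<in> ?X" for x y
    using no card that unfolding gadget_def by blast
  have "?X - {w} = insert u D" using uw uwD by auto
  then have degw: "weighted_degree ?X w = f {u, w} + int d * b"
    unfolding weighted_degree_def using fD uwD w D by (simp add: insert_commute)
  have degx: "weighted_degree ?X x = f {u, x} + int d * b" if x: "x \<in> D" for x
  proof -
    have "?X - {x} = insert u (insert w (D - {x}))" using x uwD by auto
    then have "weighted_degree ?X x = f {u, x} + (f {w, x} + (\<Sum>a\<in>D - {x}. f {x, a}))"
      unfolding weighted_degree_def using fD uwD uw by (simp add: insert_commute)
    also have "(\<Sum>a\<in>D - {x}. f {x, a}) = (\<Sum>a\<in>D - {x}. b)"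
      by (rule sum.cong) (use x D R in \<open>auto intro!: monochromaticD[of b R]\<close>)
    also have "\<dots> = int (d - 1) * b" using fD x D by simp
    also have "f {w, x} + int (d - 1) * b = int d * b"
    proof -
      have "d \<ge> 1" using d by (cases d) auto
      then show ?thesis using w[OF x] by (simp add: algebra_simps)
    qed
    finally show ?thesis .
  qed
  have eq: "f {u, x} = f {u, w}" if x: "x \<in> D" for x
  proof -
    have "[f {u, x} + int d * b = f {u, w} + int d * b] (mod int p)"
      using reg[of x w] x unfolding degx[OF x] degw by simp
    then have "[f {u, x} = f {u, w}] (mod int p)" by (simp only: cong_add_rcancel)
    then show ?thesis by (rule colour_eqI)
  qed
  have "?X - {u} = insert w D" using uw uwD by auto
  then have "weighted_degree ?X u = f {u, w} + int d * f {u, w}"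
    unfolding weighted_degree_def using fD uwD eq D by simp
  then have "[int d * f {u, w} = int d * b] (mod int p)"
    using reg[of u w] degw by (simp add: cong_add_lcancel)
  then have "[int d * (f {u, w} - b) = 0] (mod int p)"
    by (simp only: cong_diff_iff_cong_0 right_diff_distrib)
  then have "[f {u, w} - b = 0] (mod int p)" by (rule cong_mult_nat_0[OF d])
  then have "[f {u, w} = b] (mod int p)" by (simp add: cong_diff_iff_cong_0)
  then have "f {u, w} = b" using range[of "{u, w}"] b by (simp add: cong_def)
  then show False using uw by simp
qed

text \<open>If \<open>w\<close> has an edge of another colour to \<open>z\<close>, then
  \<open>meet\<close> gives \<open>u\<close> only edges of colour \<open>b\<close> to the points
  other than \<open>z\<close>. So \<open>u\<close> and \<open>w\<close> change roles and
  \<open>D\<close> is chosen off \<open>z\<close>, which is why \<open>d + 1\<close> points are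
  required.\<close>

lemma gadget_from_edge:
  assumes R: "finite R" "monochromatic b R" and uw: "u \<noteq> w" "f {u, w} \<noteq> b" and d: "\<not> p dvd d"
    and size: "card (R - {u, w}) \<ge> d + 1" and b: "b \<in> {0..<int p}"
    and meet: "\<And>x y. x \<in> R - {u, w} \<Longrightarrow> y \<in> R - {u, w} \<Longrightarrow> x \<noteq> y \<Longrightarrow> f {u, x} = b \<or> f {w, y} = b"
  obtains D where "D \<subseteq> R - {u, w}" "gadget d ({u, w} \<union> D)"
proof (cases "\<exists>z\<in>R - {u, w}. f {w, z} \<noteq> b")
  case False
  obtain D where D: "D \<subseteq> R - {u, w}" "card D = d"
    using size obtain_subset_with_card_n[of d "R - {u, w}"] by auto
  have "gadget d ({u, w} \<union> D)"
    by (rule gadget_from_edge_one_sided[OF R uw d D _ b]) (use False D in blast)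
  with D show thesis using that by blast
next
  case True
  then obtain z where z: "z \<in> R - {u, w}" "f {w, z} \<noteq> b" by blast
  have "card (R - {u, w} - {z}) = card (R - {u, w}) - 1" using z R by simp
  then have "d \<le> card (R - {u, w} - {z})" using size by simp
  then obtain D where D: "D \<subseteq> R - {u, w} - {z}" "card D = d"
    using obtain_subset_with_card_n[of d "R - {u, w} - {z}"] by auto
  have "gadget d ({w, u} \<union> D)"
  proof (rule gadget_from_edge_one_sided[OF R _ _ d])
    show "D \<subseteq> R - {w, u}" using D by blast
    show "f {u, x} = b" if "x \<in> D" for x using meet[of x z] z D that by blast
  qed (use D uw b in \<open>auto simp: insert_commute\<close>)
  then have "gadget d ({u, w} \<union> D)" by (simp add: insert_commute)
  with D show thesis using that by blast
qed

end

section \<open>Graphs and packings\<close>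

lemma simple_graph_finite_edges: "simple_graph V E \<Longrightarrow> finite E"
  unfolding simple_graph_def using finite_imp_finite_nsets finite_subset by blast

lemma simple_graph_edge:
  assumes "simple_graph V E" "{u, v} \<in> E"
  shows "u \<in> V" "v \<in> V" "u \<noteq> v"
proof -
  have *: "{u, v} \<subseteq> V" "card {u, v} = 2" using assms unfolding simple_graph_def nsets_def by auto
  then show "u \<in> V" "v \<in> V" by auto
  show "u \<noteq> v" using * by auto
qed

lemma simple_graph_edgeE:
  assumes "simple_graph V E" "e \<in> E"
  obtains u v where "e = {u, v}" "u \<noteq> v" "u \<in> V" "v \<in> V"
proof -
  have "card e = 2" "e \<subseteq> V" using assms unfolding simple_graph_def nsets_def by auto
  then show thesis using that unfolding card_2_iff by auto
qed

lemma nbhd_subset: "simple_graph V E \<Longrightarrow> nbhd E v \<subseteq> V"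
  unfolding nbhd_def using simple_graph_edge by fast

lemma nbhd_finite: "simple_graph V E \<Longrightarrow> finite (nbhd E v)"
  using nbhd_subset[of V E v] finite_subset unfolding simple_graph_def by blast

lemma nbhd_irrefl: "simple_graph V E \<Longrightarrow> v \<notin> nbhd E v"
  unfolding nbhd_def using simple_graph_edge(3) by fast

lemma card_closed_nbhd: "simple_graph V E \<Longrightarrow> card (closed_nbhd E v) = vertex_degree E v + 1"
  unfolding closed_nbhd_def vertex_degree_def using nbhd_finite nbhd_irrefl by (metis Suc_eq_plus1 card_insert_disjoint)

lemma two_packing_independent:
  assumes G: "simple_graph V E" and S: "two_packing V E S" and uv: "u \<in> S" "v \<in> S"
  shows "{u, v} \<notin> E"
proof
  assume e: "{u, v} \<in> E"
  then have "u \<noteq> v" using simple_graph_edge(3)[OF G] by blast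
  then have "closed_nbhd E u \<inter> closed_nbhd E v = {}" using S uv unfolding two_packing_def by blast
  then show False using e unfolding closed_nbhd_def nbhd_def by auto
qed

lemma two_packing_nbhd_disjoint:
  assumes S: "two_packing V E S" and "u \<in> S" "v \<in> S" "w \<in> nbhd E u" "w \<in> nbhd E v"
  shows "u = v"
  using assms unfolding two_packing_def closed_nbhd_def by blast

lemma two_packing_subset: "two_packing V E S \<Longrightarrow> S \<subseteq> V"
  unfolding two_packing_def by blast

lemma card_packing_union:
  assumes G: "simple_graph V E" and S: "two_packing V E S" and T: "T \<subseteq> S"
  shows "card (\<Union>v\<in>T. closed_nbhd E v) = (\<Sum>v\<in>T. vertex_degree E v + 1)"
proof -
  have "finite S" using G S finite_subset unfolding simple_graph_def two_packing_def by blast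
  then have "finite T" using T finite_subset by blast
  moreover have "\<forall>i\<in>T. finite (closed_nbhd E i)"
    unfolding closed_nbhd_def using nbhd_finite[OF G] by simp
  moreover have "\<forall>i\<in>T. \<forall>j\<in>T. i \<noteq> j \<longrightarrow> closed_nbhd E i \<inter> closed_nbhd E j = {}"
    using S T unfolding two_packing_def by blast
  ultimately have "card (\<Union>v\<in>T. closed_nbhd E v) = (\<Sum>v\<in>T. card (closed_nbhd E v))"
    by (rule card_UN_disjoint)
  then show ?thesis using card_closed_nbhd[OF G] by simp
qed

lemma packing_union_subset:
  "simple_graph V E \<Longrightarrow> two_packing V E S \<Longrightarrow> (\<Union>v\<in>S. closed_nbhd E v) \<subseteq> V"
  unfolding closed_nbhd_def two_packing_def using nbhd_subset[of V E] by blast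

section \<open>Sums over the edges of a graph\<close>

lemma sum_edges_split_independent:
  fixes F :: "'a set \<Rightarrow> int"
  assumes G: "simple_graph V E" and S: "S \<subseteq> V" and ind: "\<And>u v. u \<in> S \<Longrightarrow> v \<in> S \<Longrightarrow> {u, v} \<notin> E"
  shows "(\<Sum>e\<in>E. F e) = (\<Sum>e\<in>{e \<in> E. e \<inter> S = {}}. F e) + (\<Sum>v\<in>S. \<Sum>u\<in>nbhd E v. F {v, u})"
proof -
  have finE: "finite E" using simple_graph_finite_edges[OF G] .
  have finS: "finite S" using G S finite_subset unfolding simple_graph_def by blast
  let ?star = "\<lambda>v. (\<lambda>u. {v, u}) ` nbhd E v"
  have cover: "{e \<in> E. e \<inter> S \<noteq> {}} = (\<Union>v\<in>S. ?star v)"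
  proof (intro equalityI subsetI)
    fix e assume "e \<in> {e \<in> E. e \<inter> S \<noteq> {}}"
    then have e: "e \<in> E" "e \<inter> S \<noteq> {}" by auto
    obtain u v where "e = {u, v}" using simple_graph_edgeE[OF G e(1)] by blast
    then obtain x y where "e = {x, y}" "x \<in> S" using e(2) by (auto simp: insert_commute)
    then show "e \<in> (\<Union>v\<in>S. ?star v)" using e(1) unfolding nbhd_def by blast
  next
    fix e assume "e \<in> (\<Union>v\<in>S. ?star v)"
    then show "e \<in> {e \<in> E. e \<inter> S \<noteq> {}}" unfolding nbhd_def by auto
  qed
  have disj: "\<forall>i\<in>S. \<forall>j\<in>S. i \<noteq> j \<longrightarrow> ?star i \<inter> ?star j = {}"
  proof (intro ballI impI equals0I)
    fix i j e assume ij: "i \<in> S" "j \<in> S" "i \<noteq> j" and e: "e \<in> ?star i \<inter> ?star j"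
    then obtain u w where "e = {i, u}" "e = {j, w}" "{i, u} \<in> E" unfolding nbhd_def by blast
    then have "{i, j} \<in> E" using ij by (auto simp: doubleton_eq_iff)
    then show False using ind ij by blast
  qed
  have "E = {e \<in> E. e \<inter> S = {}} \<union> {e \<in> E. e \<inter> S \<noteq> {}}" by blast
  then have "(\<Sum>e\<in>E. F e) = (\<Sum>e\<in>{e \<in> E. e \<inter> S = {}} \<union> {e \<in> E. e \<inter> S \<noteq> {}}. F e)" by simp
  also have "\<dots> = (\<Sum>e\<in>{e \<in> E. e \<inter> S = {}}. F e) + (\<Sum>e\<in>{e \<in> E. e \<inter> S \<noteq> {}}. F e)"
    by (rule sum.union_disjoint) (use finE in auto)
  also have "(\<Sum>e\<in>{e \<in> E. e \<inter> S \<noteq> {}}. F e) = (\<Sum>v\<in>S. \<Sum>e\<in>?star v. F e)"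
    unfolding cover by (rule sum.UNION_disjoint) (use finS nbhd_finite[OF G] disj in auto)
  also have "\<dots> = (\<Sum>v\<in>S. \<Sum>u\<in>nbhd E v. F {v, u})"
  proof (rule sum.cong[OF refl])
    fix v
    have "inj_on (\<lambda>u. {v, u}) (nbhd E v)" by (auto simp: inj_on_def doubleton_eq_iff)
    then show "(\<Sum>e\<in>?star v. F e) = (\<Sum>u\<in>nbhd E v. F {v, u})" by (simp add: sum.reindex)
  qed
  finally show ?thesis .
qed

lemma card_edges_at_vertex:
  assumes G: "simple_graph V E"
  shows "card {e \<in> E. v \<in> e} = vertex_degree E v"
proof -
  have "{e \<in> E. v \<in> e} = (\<lambda>u. {v, u}) ` nbhd E v"
  proof (intro equalityI subsetI)
    fix e assume e: "e \<in> {e \<in> E. v \<in> e}"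
    then obtain x y where "e = {x, y}" using simple_graph_edgeE[OF G] by blast
    then show "e \<in> (\<lambda>u. {v, u}) ` nbhd E v" using e unfolding nbhd_def by (auto simp: insert_commute)
  qed (auto simp: nbhd_def)
  moreover have "inj_on (\<lambda>u. {v, u}) (nbhd E v)" by (auto simp: inj_on_def doubleton_eq_iff)
  ultimately show ?thesis unfolding vertex_degree_def by (simp add: card_image)
qed

text \<open>Double counting of incidences. It turns the sum of an additive colouring over a copy
  into a sum over vertices weighted by degrees.\<close>

lemma sum_edges_vertex_sums:
  fixes h :: "'a \<Rightarrow> int"
  assumes G: "simple_graph V E"
  shows "(\<Sum>e\<in>E. \<Sum>v\<in>e. h v) = (\<Sum>v\<in>V. int (vertex_degree E v) * h v)"
proof -
  have fin: "finite V" "finite E" using G simple_graph_finite_edges unfolding simple_graph_def by auto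
  have "(\<Sum>e\<in>E. \<Sum>v\<in>e. h v) = (\<Sum>e\<in>E. \<Sum>v\<in>{v \<in> V. v \<in> e}. h v)"
  proof (rule sum.cong[OF refl])
    fix e assume "e \<in> E"
    then have "{v \<in> V. v \<in> e} = e" using G unfolding simple_graph_def nsets_def by auto
    then show "(\<Sum>v\<in>e. h v) = (\<Sum>v\<in>{v \<in> V. v \<in> e}. h v)" by simp
  qed
  also have "\<dots> = (\<Sum>v\<in>V. \<Sum>e\<in>{e \<in> E. v \<in> e}. h v)" by (rule sum.swap_restrict[OF fin(2,1)])
  also have "\<dots> = (\<Sum>v\<in>V. int (vertex_degree E v) * h v)"
    using card_edges_at_vertex[OF G] by simp
  finally show ?thesis .
qed

lemma handshake:
  assumes G: "simple_graph V E"
  shows "(\<Sum>v\<in>V. int (vertex_degree E v)) = 2 * int (card E)"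
proof -
  have "(\<Sum>v\<in>V. int (vertex_degree E v)) = (\<Sum>e\<in>E. \<Sum>v\<in>e. 1 :: int)"
    using sum_edges_vertex_sums[OF G, of "\<lambda>_. 1"] by simp
  also have "\<dots> = (\<Sum>e\<in>E. 2)"
    by (rule sum.cong) (use G in \<open>auto simp: simple_graph_def nsets_def\<close>)
  finally show ?thesis by simp
qed

text \<open>A vertex of \<open>B\<close> has at most one forbidden place, so a target with one spare element suffices.\<close>

lemma injection_avoiding:
  assumes "finite B" "finite I" "card I > card B"
  obtains g where "inj_on g B" "g ` B \<subseteq> I" "\<And>w. w \<in> B \<Longrightarrow> g w \<noteq> z w"
proof -
  have "\<exists>g. inj_on g B \<and> g ` B \<subseteq> I \<and> (\<forall>w\<in>B. g w \<noteq> z w)"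
    using assms(1,3)
  proof (induction B rule: finite_induct)
    case (insert b B)
    then obtain g where g: "inj_on g B" "g ` B \<subseteq> I" "\<forall>w\<in>B. g w \<noteq> z w" by auto
    have "card (insert (z b) (g ` B)) \<le> Suc (card B)"
      using card_insert_le_m1 card_image_le[OF insert.hyps(1), of g] by (metis Suc_le_mono card_insert_if finite_imageI insert.hyps(1) le_Suc_eq le_trans)
    then have "card (insert (z b) (g ` B)) < card I" using insert by simp
    then have "\<not> I \<subseteq> insert (z b) (g ` B)"
      using insert.hyps card_mono[of "insert (z b) (g ` B)" I] by auto
    then obtain y where y: "y \<in> I" "y \<noteq> z b" "y \<notin> g ` B" by blast
    have "inj_on (g(b := y)) (insert b B)" using g(1) y(3) insert.hyps by (auto simp: inj_on_def)
    moreover have "(g(b := y)) ` insert b B \<subseteq> I" using g(2) y(1) by auto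
    moreover have "\<forall>w\<in>insert b B. (g(b := y)) w \<noteq> z w" using g(3) y(2) by auto
    ultimately show ?case by blast
  qed auto
  then show thesis using that by blast
qed

lemma inj_on_UN_blocks:
  assumes "\<And>i. i \<in> I \<Longrightarrow> inj_on g (B i)"
    and "\<And>i j. i \<in> I \<Longrightarrow> j \<in> I \<Longrightarrow> i \<noteq> j \<Longrightarrow> g ` B i \<inter> g ` B j = {}"
  shows "inj_on g (\<Union>i\<in>I. B i)"
proof (rule inj_onI)
  fix x y assume x: "x \<in> (\<Union>i\<in>I. B i)" and y: "y \<in> (\<Union>i\<in>I. B i)" and eq: "g x = g y"
  from x y obtain i j where ij: "i \<in> I" "x \<in> B i" "j \<in> I" "y \<in> B j" by blast
  then have "i = j" using assms(2)[of i j] eq by (metis disjoint_iff imageI)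
  then show "x = y" using assms(1)[of i] ij eq unfolding inj_on_def by blast
qed

section \<open>Zero-sum embeddings\<close>

text \<open>If some residue is attained at least \<open>card W\<close> times, all of \<open>W\<close> is placed there. Otherwise
  sort \<open>R\<close> by residue and put the elements into \<open>card W\<close> classes by their position modulo \<open>card W\<close>:
  the residues in one class are distinct, so Cauchy--Davenport applies to the classes.\<close>

lemma weighted_zero_sum:
  fixes p :: nat and w :: "'a \<Rightarrow> int" and h :: "'b \<Rightarrow> int"
  assumes p: "prime p" and W: "finite W" "\<And>v. v \<in> W \<Longrightarrow> \<not> [w v = 0] (mod int p)"
    and sum0: "[(\<Sum>v\<in>W. w v) = 0] (mod int p)"
    and R: "finite R" "card R \<ge> card W + p - 1"
  obtains \<phi> where "inj_on \<phi> W" "\<phi> ` W \<subseteq> R" "[(\<Sum>v\<in>W. w v * h (\<phi> v)) = 0] (mod int p)"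
proof -
  have p0: "p > 0" "int p > 0" using p by (simp_all add: prime_gt_0_nat)
  define q where "q = card W"
  define k where "k y = h y mod int p" for y
  show thesis
  proof (cases "\<exists>b. card {y \<in> R. k y = b} \<ge> q")
    case True
    then obtain b where "card {y \<in> R. k y = b} \<ge> q" by blast
    then obtain \<phi> where \<phi>: "inj_on \<phi> W" "\<phi> ` W \<subseteq> {y \<in> R. k y = b}"
      using inj_on_iff_card_le[of W "{y \<in> R. k y = b}"] W R unfolding q_def by auto
    have "[(\<Sum>v\<in>W. w v * h (\<phi> v)) = (\<Sum>v\<in>W. w v * b)] (mod int p)"
    proof (intro cong_sum cong_mult cong_refl)
      fix v assume "v \<in> W"
      then have "h (\<phi> v) mod int p = b" using \<phi> unfolding k_def by auto
      then show "[h (\<phi> v) = b] (mod int p)" by (auto simp: cong_def)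
    qed
    also have "(\<Sum>v\<in>W. w v * b) = (\<Sum>v\<in>W. w v) * b" by (simp add: sum_distrib_right)
    also have "[(\<Sum>v\<in>W. w v) * b = 0 * b] (mod int p)" by (intro cong_mult sum0 cong_refl)
    finally show thesis using that[OF \<phi>(1)] \<phi>(2) by auto
  next
    case False
    then have small: "card {y \<in> R. k y = b} < q" for b by (meson not_le)
    have q0: "q > 0" using small[of 0] by simp
    obtain ys0 where ys0: "set ys0 = R" "distinct ys0" using R(1) finite_distinct_list by blast
    define ys where "ys = sort_key k ys0"
    have ys: "set ys = R" "distinct ys" "sorted (map k ys)" unfolding ys_def using ys0 by auto
    have len: "length ys = card R" using ys distinct_card by metis
    \<comment> \<open>Distinct positions congruent modulo \<open>q\<close> are at least
      \<open>q\<close> apart. In a sorted list, equal residues there would be shared by all entries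
      in between, but no residue occurs \<open>q\<close> times.\<close>
    have spread: "k (ys ! i) \<noteq> k (ys ! j)" if ij: "i < j" "j < length ys" "i mod q = j mod q" for i j
    proof
      assume eq: "k (ys ! i) = k (ys ! j)"
      have "q dvd j - i" using ij mod_eq_dvd_iff_nat[of i j q] by simp
      then have far: "q \<le> j - i" using ij dvd_imp_le by simp
      have "(!) ys ` {i..j} \<subseteq> {y \<in> R. k y = k (ys ! i)}"
      proof
        fix y assume "y \<in> (!) ys ` {i..j}"
        then obtain l where l: "i \<le> l" "l \<le> j" "y = ys ! l" by auto
        have "k (ys ! i) \<le> k (ys ! l)" "k (ys ! l) \<le> k (ys ! j)"
          using sorted_nth_mono[OF ys(3), of i l] sorted_nth_mono[OF ys(3), of l j] l ij by auto
        moreover have "y \<in> R" using l ij ys(1) by auto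
        ultimately show "y \<in> {y \<in> R. k y = k (ys ! i)}" using eq l by auto
      qed
      moreover have "card ((!) ys ` {i..j}) = j + 1 - i"
        using ys(2) ij by (subst card_image) (auto simp: inj_on_def nth_eq_iff_index_eq)
      ultimately have "j + 1 - i \<le> card {y \<in> R. k y = k (ys ! i)}"
        using card_mono[of "{y \<in> R. k y = k (ys ! i)}" "(!) ys ` {i..j}"] R(1) by simp
      then show False using small[of "k (ys ! i)"] far ij by simp
    qed
    obtain en where en: "bij_betw en W {..<q}"
      using ex_bij_betw_finite_nat[OF W(1)] unfolding q_def atLeast0LessThan by blast
    have enq: "en v < q" if "v \<in> W" for v using en that bij_betwE by blast
    define J where "J v = {j. j < length ys \<and> j mod q = en v}" for v
    define A where "A v = (\<lambda>j. (w v * k (ys ! j)) mod int p) ` J v" for v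
    have finJ: "finite (J v)" for v unfolding J_def by simp
    have Asub: "A v \<subseteq> {0..<int p}" for v unfolding A_def using p0 by auto
    \<comment> \<open>Since \<open>p \<ge> 1\<close>, \<open>card R\<close> is at least
      \<open>card W\<close>, so every class contains its first position.\<close>
    have Jne: "en v \<in> J v" if "v \<in> W" for v
      using enq[OF that] R(2) p0 unfolding J_def len q_def by simp
    have cardA: "card (A v) = card (J v)" if v: "v \<in> W" for v
      unfolding A_def
    proof (rule card_image, rule inj_onI)
      fix i j assume ij: "i \<in> J v" "j \<in> J v"
        and eq: "w v * k (ys ! i) mod int p = w v * k (ys ! j) mod int p"
      have "coprime (w v) (int p)"
        using W(2)[OF v] p prime_imp_coprime[of "int p" "w v"] by (simp add: cong_0_iff coprime_commute)
      then have "[k (ys ! i) = k (ys ! j)] (mod int p)"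
        using eq cong_mult_lcancel[of "w v" "int p"] by (simp add: cong_def)
      then have "k (ys ! i) = k (ys ! j)" unfolding k_def by (simp add: cong_def)
      then show "i = j" using spread[of i j] spread[of j i] ij unfolding J_def by (cases i j rule: linorder_cases) auto
    qed
    have "(\<Sum>v\<in>W. card (J v)) = card (\<Union>v\<in>W. J v)"
    proof (rule card_UN_disjoint[symmetric])
      show "\<forall>i\<in>W. \<forall>j\<in>W. i \<noteq> j \<longrightarrow> J i \<inter> J j = {}"
        using en unfolding J_def bij_betw_def inj_on_def by auto
    qed (use W finJ in auto)
    also have "(\<Union>v\<in>W. J v) = {..<length ys}"
    proof
      show "{..<length ys} \<subseteq> (\<Union>v\<in>W. J v)"
      proof
        fix j assume j: "j \<in> {..<length ys}"
        have "j mod q \<in> en ` W" using en q0 unfolding bij_betw_def by auto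
        then show "j \<in> (\<Union>v\<in>W. J v)" using j unfolding J_def by auto
      qed
    qed (auto simp: J_def)
    finally have total: "(\<Sum>v\<in>W. card (J v)) = card R" using len by simp
    \<comment> \<open>The \<open>card W\<close> classes have \<open>card R\<close> positions in
      total, so their excesses over one add up to \<open>card R - card W\<close>, which is at least
      \<open>p - 1\<close>.\<close>
    have "(\<Sum>v\<in>W. card (A v) - 1) + card W = (\<Sum>v\<in>W. (card (A v) - 1) + 1)"
      by (simp only: sum.distrib) simp
    also have "\<dots> = (\<Sum>v\<in>W. card (J v))"
    proof (rule sum.cong[OF refl])
      fix v assume v: "v \<in> W"
      have "card (J v) > 0" using Jne[OF v] finJ card_gt_0_iff by blast
      then show "card (A v) - 1 + 1 = card (J v)" using cardA[OF v] by simp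
    qed
    finally have big: "p - 1 \<le> (\<Sum>v\<in>W. card (A v) - 1)" using total R(2) by linarith
    have Aok: "A v \<subseteq> {0..<int p} \<and> A v \<noteq> {}" if "v \<in> W" for v
      using Asub Jne[OF that] unfolding A_def by blast
    obtain c where c: "\<And>v. v \<in> W \<Longrightarrow> c v \<in> A v" "[(\<Sum>v\<in>W. c v) = 0] (mod int p)"
      using choice_sum_cong[OF p W(1) Aok big, of 0] by blast
    then have "\<forall>v\<in>W. \<exists>j. j \<in> J v \<and> c v = (w v * k (ys ! j)) mod int p" unfolding A_def by blast
    then obtain j where j: "\<And>v. v \<in> W \<Longrightarrow> j v \<in> J v"
      "\<And>v. v \<in> W \<Longrightarrow> c v = (w v * k (ys ! j v)) mod int p" by metis
    define \<phi> where "\<phi> v = ys ! j v" for v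
    have inj: "inj_on \<phi> W"
    proof (rule inj_onI)
      fix u v assume uv: "u \<in> W" "v \<in> W" "\<phi> u = \<phi> v"
      then have "j u = j v" using j(1) ys(2) unfolding \<phi>_def J_def by (auto simp: nth_eq_iff_index_eq)
      then have "en u = en v" using j(1)[OF uv(1)] j(1)[OF uv(2)] unfolding J_def by auto
      then show "u = v" using en uv unfolding bij_betw_def inj_on_def by auto
    qed
    have sub: "\<phi> ` W \<subseteq> R" using j(1) ys(1) unfolding \<phi>_def J_def by auto
    have "[(\<Sum>v\<in>W. w v * h (\<phi> v)) = (\<Sum>v\<in>W. c v)] (mod int p)"
    proof (rule cong_sum)
      fix v assume v: "v \<in> W"
      show "[w v * h (\<phi> v) = c v] (mod int p)"
        unfolding j(2)[OF v] \<phi>_def k_def by (simp add: cong_def mod_simps)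
    qed
    then show thesis using that[OF inj sub] c(2) cong_trans by blast
  qed
qed

context residue_colouring
begin

definition zero_sum_embedding :: "'a set \<Rightarrow> 'a set set \<Rightarrow> 'b set \<Rightarrow> bool" where
  "zero_sum_embedding V E P \<longleftrightarrow>
     (\<exists>\<phi>. inj_on \<phi> V \<and> \<phi> ` V \<subseteq> P \<and> [(\<Sum>e\<in>E. f (\<phi> ` e)) = 0] (mod int p))"

text \<open>Only the vertices of degree nonzero modulo \<open>p\<close> matter for the sum; the others are placed arbitrarily.\<close>

lemma zero_sum_embedding_additive:
  assumes G: "simple_graph V E" and dvd: "p dvd card E"
    and R: "finite R" "card R \<ge> card V + p - 1"
    and add: "\<And>x y. x \<in> R \<Longrightarrow> y \<in> R \<Longrightarrow> x \<noteq> y \<Longrightarrow> [f {x, y} = h x + h y + \<kappa>] (mod int p)"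
  shows "zero_sum_embedding V E R"
proof -
  have fV: "finite V" using G unfolding simple_graph_def by blast
  have p1: "p \<ge> 1" using prime_gt_0_nat[OF prime_p] by simp
  let ?w = "\<lambda>v. int (vertex_degree E v)"
  define W where "W = {v \<in> V. \<not> [?w v = 0] (mod int p)}"
  have W: "W \<subseteq> V" "finite W" unfolding W_def using fV by auto
  have edges0: "[int (card E) = 0] (mod int p)" using dvd by (simp add: cong_0_iff)
  have restrict: "[(\<Sum>v\<in>V. ?w v * t v) = (\<Sum>v\<in>W. ?w v * t v)] (mod int p)" for t
  proof -
    have "(\<Sum>v\<in>V. ?w v * t v) = (\<Sum>v\<in>V - W. ?w v * t v) + (\<Sum>v\<in>W. ?w v * t v)"
      using W fV by (simp add: sum.subset_diff)
    also have "[\<dots> = (\<Sum>v\<in>V - W. 0) + (\<Sum>v\<in>W. ?w v * t v)] (mod int p)"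
    proof (intro cong_add cong_refl cong_sum)
      fix v assume "v \<in> V - W"
      then have "[?w v = 0] (mod int p)" unfolding W_def by blast
      then show "[?w v * t v = 0] (mod int p)" using cong_mult[of "?w v" 0 "int p" "t v" "t v"] by simp
    qed
    finally show ?thesis by simp
  qed
  \<comment> \<open>\<open>weighted_zero_sum\<close> needs weights with sum zero; by
    \<open>handshake\<close> the degrees add up to twice the number of edges.\<close>
  have "[(\<Sum>v\<in>W. ?w v * 1) = (\<Sum>v\<in>V. ?w v * 1)] (mod int p)" by (rule cong_sym[OF restrict])
  also have "(\<Sum>v\<in>V. ?w v * 1) = 2 * int (card E)" using handshake[OF G] by simp
  also have "[2 * int (card E) = 2 * 0] (mod int p)" by (intro cong_mult cong_refl edges0)
  finally have sum0: "[(\<Sum>v\<in>W. ?w v) = 0] (mod int p)" by simp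
  have "card W \<le> card V" using W fV card_mono by blast
  then have cardR: "card R \<ge> card W + p - 1" using R p1 by linarith
  obtain \<phi>0 where \<phi>0: "inj_on \<phi>0 W" "\<phi>0 ` W \<subseteq> R" "[(\<Sum>v\<in>W. ?w v * h (\<phi>0 v)) = 0] (mod int p)"
    using weighted_zero_sum[OF prime_p W(2) _ sum0 R(1) cardR] unfolding W_def by blast
  have "card (V - W) \<le> card (R - \<phi>0 ` W)"
    using W \<phi>0 fV R p1 by (simp add: card_Diff_subset card_image)
  then obtain g where g: "inj_on g (V - W)" "g ` (V - W) \<subseteq> R - \<phi>0 ` W"
    using inj_on_iff_card_le[of "V - W" "R - \<phi>0 ` W"] fV R by auto
  define \<phi> where "\<phi> v = (if v \<in> W then \<phi>0 v else g v)" for v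
  have "inj_on \<phi> W" "\<phi> ` W = \<phi>0 ` W" "inj_on \<phi> (V - W)" "\<phi> ` (V - W) = g ` (V - W)"
    unfolding \<phi>_def using \<phi>0(1) g(1) by (auto simp: inj_on_def)
  then have "inj_on \<phi> (W \<union> (V - W))" using g(2) by (simp only: inj_on_Un) blast
  then have inj: "inj_on \<phi> V" using W(1) by (simp add: Un_absorb1)
  have sub: "\<phi> ` V \<subseteq> R" using \<phi>0(2) g(2) unfolding \<phi>_def by auto
  have "[(\<Sum>e\<in>E. f (\<phi> ` e)) = (\<Sum>e\<in>E. (\<Sum>v\<in>e. h (\<phi> v)) + \<kappa>)] (mod int p)"
  proof (rule cong_sum)
    fix e assume "e \<in> E"
    then obtain u v where e: "e = {u, v}" "u \<noteq> v" "u \<in> V" "v \<in> V" by (rule simple_graph_edgeE[OF G])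
    then have "\<phi> u \<noteq> \<phi> v" "\<phi> u \<in> R" "\<phi> v \<in> R" using inj sub unfolding inj_on_def by auto
    then have "[f {\<phi> u, \<phi> v} = h (\<phi> u) + h (\<phi> v) + \<kappa>] (mod int p)" using add by blast
    then show "[f (\<phi> ` e) = (\<Sum>v\<in>e. h (\<phi> v)) + \<kappa>] (mod int p)" using e by simp
  qed
  \<comment> \<open>The constant \<open>\<kappa>\<close> is counted once per edge and vanishes
    because \<open>p\<close> divides their number.\<close>
  also have "(\<Sum>e\<in>E. (\<Sum>v\<in>e. h (\<phi> v)) + \<kappa>) = (\<Sum>v\<in>V. ?w v * h (\<phi> v)) + int (card E) * \<kappa>"
    using sum_edges_vertex_sums[OF G, of "\<lambda>v. h (\<phi> v)"] by (simp add: sum.distrib)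
  also have "[\<dots> = (\<Sum>v\<in>W. ?w v * h (\<phi> v)) + 0 * \<kappa>] (mod int p)"
    by (intro cong_add cong_mult restrict edges0 cong_refl)
  also have "(\<Sum>v\<in>W. ?w v * h (\<phi> v)) + 0 * \<kappa> = (\<Sum>v\<in>W. ?w v * h (\<phi>0 v))"
    by (simp add: \<phi>_def)
  also note \<phi>0(3)
  finally show ?thesis unfolding zero_sum_embedding_def using inj sub by blast
qed

text \<open>Each \<open>v \<in> S\<close> has two possible places in its gadget, and the two give different sums over
  the edges at \<open>v\<close>. These changes are independent of each other, so Cauchy--Davenport applies.\<close>

lemma zero_sum_embedding_gadgets:
  assumes G: "simple_graph V E" and S: "two_packing V E S" "card S = p - 1"
    and P: "finite P" "card P \<ge> card V + p - 1"
    and X: "\<And>v. v \<in> S \<Longrightarrow> gadget (vertex_degree E v) (X v)" "\<And>v. v \<in> S \<Longrightarrow> X v \<subseteq> P"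
    and disj: "\<And>u v. u \<in> S \<Longrightarrow> v \<in> S \<Longrightarrow> u \<noteq> v \<Longrightarrow> X u \<inter> X v = {}"
  shows "zero_sum_embedding V E P"
proof -
  have fV: "finite V" using G unfolding simple_graph_def by blast
  have SV: "S \<subseteq> V" using two_packing_subset[OF S(1)] .
  have fS: "finite S" using SV fV finite_subset by blast
  have p0: "int p > 0" "p \<ge> 1" using prime_gt_0_nat[OF prime_p] by simp_all
  have ind: "{u, v} \<notin> E" if "u \<in> S" "v \<in> S" for u v
    using two_packing_independent[OF G S(1) that] .
  have "\<forall>v\<in>S. \<exists>x y A. X v = insert x (insert y A) \<and> finite A \<and> card A = vertex_degree E v \<and>
      x \<notin> A \<and> y \<notin> A \<and> x \<noteq> y \<and> \<not> [(\<Sum>a\<in>A. f {x, a}) = (\<Sum>a\<in>A. f {y, a})] (mod int p)"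
    using X(1) gadgetE by metis
  then obtain x y A where XA: "\<And>v. v \<in> S \<Longrightarrow> X v = insert (x v) (insert (y v) (A v)) \<and> finite (A v) \<and>
      card (A v) = vertex_degree E v \<and> x v \<notin> A v \<and> y v \<notin> A v \<and> x v \<noteq> y v \<and>
      \<not> [(\<Sum>a\<in>A v. f {x v, a}) = (\<Sum>a\<in>A v. f {y v, a})] (mod int p)"
    by metis
  have "\<forall>v\<in>S. \<exists>b. bij_betw b (nbhd E v) (A v)"
    using XA finite_same_card_bij[OF nbhd_finite[OF G]] unfolding vertex_degree_def by metis
  then obtain \<beta> where \<beta>: "\<And>v. v \<in> S \<Longrightarrow> bij_betw (\<beta> v) (nbhd E v) (A v)" by metis
  let ?N = "\<Union>v\<in>S. closed_nbhd E v"
  have NV: "?N \<subseteq> V" using packing_union_subset[OF G S(1)] .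
  have cardN: "card ?N = (\<Sum>v\<in>S. vertex_degree E v + 1)" using card_packing_union[OF G S(1) order.refl] .
  have "card (\<Union>v\<in>S. X v) = (\<Sum>v\<in>S. card (X v))"
    by (rule card_UN_disjoint) (use fS X(1) gadget_finite disj in auto)
  also have "\<dots> = (\<Sum>v\<in>S. (vertex_degree E v + 1) + 1)"
    by (rule sum.cong) (use X(1) gadget_card in auto)
  \<comment> \<open>Each gadget has one point more than the closed neighbourhood placed in it; this
    accounts for the \<open>p - 1\<close> points beyond \<open>card V\<close>.\<close>
  also have "\<dots> = card ?N + card S" unfolding cardN by (simp only: sum.distrib) simp
  finally have cardX: "card (\<Union>v\<in>S. X v) = card ?N + (p - 1)" using S(2) by simp
  have "(\<Union>v\<in>S. X v) \<subseteq> P" using X(2) by blast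
  then have "card (P - (\<Union>v\<in>S. X v)) = card P - card (\<Union>v\<in>S. X v)"
    using P(1) by (intro card_Diff_subset) (auto intro: finite_subset)
  moreover have "card (V - ?N) = card V - card ?N"
    using NV fV by (intro card_Diff_subset) (auto intro: finite_subset)
  ultimately have "card (V - ?N) \<le> card (P - (\<Union>v\<in>S. X v))" using P cardX p0 by linarith
  then obtain \<gamma> where \<gamma>: "inj_on \<gamma> (V - ?N)" "\<gamma> ` (V - ?N) \<subseteq> P - (\<Union>v\<in>S. X v)"
    using inj_on_iff_card_le[of "V - ?N" "P - (\<Union>v\<in>S. X v)"] fV P by auto
  \<comment> \<open>A vertex has at most one neighbour in \<open>S\<close>, since the closed
    neighbourhoods are disjoint.\<close>
  define own where "own u = (SOME v. v \<in> S \<and> u \<in> nbhd E v)" for u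
  have own: "own u = v" if "v \<in> S" "u \<in> nbhd E v" for u v
    unfolding own_def using that two_packing_nbhd_disjoint[OF S(1)] by (intro some_equality) auto
  \<comment> \<open>Only the centres depend on \<open>c\<close>: neighbours of a centre
    \<open>v\<close> keep their places in \<open>A v\<close>, and \<open>\<gamma>\<close> sends the
    remaining vertices off all gadgets.\<close>
  define \<phi> where "\<phi> c u = (if u \<in> S then c u else if u \<in> ?N then \<beta> (own u) u else \<gamma> u)" for c u
  have \<phi>S: "\<phi> c v = c v" if "v \<in> S" for c v unfolding \<phi>_def using that by simp
  have \<phi>N: "\<phi> c u = \<beta> v u" if "v \<in> S" "u \<in> nbhd E v" for c u v
  proof -
    have "u \<notin> S" using ind[OF that(1), of u] that(2) unfolding nbhd_def by blast
    moreover have "u \<in> ?N" using that unfolding closed_nbhd_def by blast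
    ultimately show ?thesis unfolding \<phi>_def using own[OF that] by simp
  qed
  have \<phi>out: "\<phi> c u = \<gamma> u" if "u \<in> V - ?N" for c u
  proof -
    have "u \<notin> S" using that unfolding closed_nbhd_def by blast
    then show ?thesis unfolding \<phi>_def using that by simp
  qed
  have block_image: "\<phi> c ` closed_nbhd E v \<subseteq> X v" and block_inj: "inj_on (\<phi> c) (closed_nbhd E v)"
    if c: "\<And>v. v \<in> S \<Longrightarrow> c v \<in> {x v, y v}" and v: "v \<in> S" for c v
  proof -
    have im: "\<phi> c ` nbhd E v = A v"
      using \<phi>N[OF v] \<beta>[OF v] unfolding bij_betw_def by (metis image_cong)
    then show "\<phi> c ` closed_nbhd E v \<subseteq> X v"
      unfolding closed_nbhd_def using \<phi>S[OF v] c[OF v] XA[OF v] by auto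
    have "inj_on (\<phi> c) (nbhd E v)"
      using \<beta>[OF v] \<phi>N[OF v] unfolding bij_betw_def by (metis inj_on_cong)
    moreover have "\<phi> c v \<notin> A v" using \<phi>S[OF v] c[OF v] XA[OF v] by auto
    ultimately show "inj_on (\<phi> c) (closed_nbhd E v)"
      unfolding closed_nbhd_def using im by (auto simp: inj_on_insert)
  qed
  have inj: "inj_on (\<phi> c) V" and sub: "\<phi> c ` V \<subseteq> P"
    if c: "\<And>v. v \<in> S \<Longrightarrow> c v \<in> {x v, y v}" for c
  proof -
    have N1: "inj_on (\<phi> c) ?N"
    proof (rule inj_on_UN_blocks)
      fix i j assume "i \<in> S" "j \<in> S" "i \<noteq> j"
      then show "\<phi> c ` closed_nbhd E i \<inter> \<phi> c ` closed_nbhd E j = {}"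
        using block_image[OF c] disj by blast
    qed (use block_inj[OF c] in blast)
    have N2: "\<phi> c ` ?N \<subseteq> (\<Union>v\<in>S. X v)" using block_image[OF c] by blast
    have O1: "inj_on (\<phi> c) (V - ?N)" using \<gamma>(1) inj_on_cong[of "V - ?N" "\<phi> c" \<gamma>] \<phi>out by blast
    have O2: "\<phi> c ` (V - ?N) \<subseteq> P - (\<Union>v\<in>S. X v)"
      using \<gamma>(2) image_cong[OF refl, of "V - ?N" "\<phi> c" \<gamma>] \<phi>out by blast
    have V: "V = ?N \<union> (V - ?N)" using NV by blast
    have "\<phi> c ` ?N \<inter> \<phi> c ` (V - ?N) = {}" using N2 O2 by blast
    then have "inj_on (\<phi> c) (?N \<union> (V - ?N))" using N1 O1 unfolding inj_on_Un by blast
    then show "inj_on (\<phi> c) V" using V by argo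
    have "(\<Union>v\<in>S. X v) \<subseteq> P" using X(2) by blast
    then have "\<phi> c ` (?N \<union> (V - ?N)) \<subseteq> P"
      unfolding image_Un by (intro Un_least order_trans[OF N2] order_trans[OF O2 Diff_subset])
    then show "\<phi> c ` V \<subseteq> P" using V by argo
  qed
  \<comment> \<open>Here \<open>x\<close> serves as a reference choice: an edge that avoids
    \<open>S\<close> has the same image for every \<open>c\<close>.\<close>
  define fixed where "fixed = (\<Sum>e\<in>{e \<in> E. e \<inter> S = {}}. f (\<phi> x ` e))"
  define \<tau> where "\<tau> v t = (\<Sum>a\<in>A v. f {t, a})" for v t
  have total: "(\<Sum>e\<in>E. f (\<phi> c ` e)) = fixed + (\<Sum>v\<in>S. \<tau> v (c v))" for c
  proof -
    have "(\<Sum>e\<in>E. f (\<phi> c ` e)) = (\<Sum>e\<in>{e \<in> E. e \<inter> S = {}}. f (\<phi> c ` e)) +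
        (\<Sum>v\<in>S. \<Sum>u\<in>nbhd E v. f (\<phi> c ` {v, u}))"
      by (rule sum_edges_split_independent[OF G SV ind])
    also have "(\<Sum>e\<in>{e \<in> E. e \<inter> S = {}}. f (\<phi> c ` e)) = fixed" unfolding fixed_def
    proof (rule sum.cong[OF refl])
      fix e assume "e \<in> {e \<in> E. e \<inter> S = {}}"
      then have "\<phi> c ` e = \<phi> x ` e" by (intro image_cong) (auto simp: \<phi>_def)
      then show "f (\<phi> c ` e) = f (\<phi> x ` e)" by simp
    qed
    also have "(\<Sum>v\<in>S. \<Sum>u\<in>nbhd E v. f (\<phi> c ` {v, u})) = (\<Sum>v\<in>S. \<tau> v (c v))"
    proof (rule sum.cong[OF refl])
      fix v assume v: "v \<in> S"
      have "(\<Sum>u\<in>nbhd E v. f (\<phi> c ` {v, u})) = (\<Sum>u\<in>nbhd E v. f {c v, \<beta> v u})"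
        by (rule sum.cong) (simp_all add: \<phi>S[OF v] \<phi>N[OF v])
      also have "\<dots> = \<tau> v (c v)" unfolding \<tau>_def by (rule sum.reindex_bij_betw[OF \<beta>[OF v]])
      finally show "(\<Sum>u\<in>nbhd E v. f (\<phi> c ` {v, u})) = \<tau> v (c v)" .
    qed
    finally show ?thesis .
  qed
  define T where "T v = {\<tau> v (x v) mod int p, \<tau> v (y v) mod int p}" for v
  have T: "T v \<subseteq> {0..<int p} \<and> T v \<noteq> {}" for v unfolding T_def using p0 by auto
  have "card (T v) = 2" if "v \<in> S" for v
    using XA[OF that] unfolding T_def \<tau>_def by (simp add: cong_def)
  then have "(\<Sum>v\<in>S. card (T v) - 1) = card S" by simp
  then have big: "p - 1 \<le> (\<Sum>v\<in>S. card (T v) - 1)" using S(2) by simp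
  \<comment> \<open>The choices at the centres have to cancel what the edges off \<open>S\<close>
    contribute.\<close>
  obtain s where s: "\<And>v. v \<in> S \<Longrightarrow> s v \<in> T v" "[(\<Sum>v\<in>S. s v) = - fixed] (mod int p)"
    using choice_sum_cong[OF prime_p fS T big, where t = "- fixed"] by blast
  have "\<forall>v\<in>S. \<exists>t\<in>{x v, y v}. s v = \<tau> v t mod int p" using s(1) unfolding T_def by blast
  then obtain c where c: "\<And>v. v \<in> S \<Longrightarrow> c v \<in> {x v, y v}" "\<And>v. v \<in> S \<Longrightarrow> s v = \<tau> v (c v) mod int p"
    by metis
  have "[fixed + (\<Sum>v\<in>S. \<tau> v (c v)) = fixed + (\<Sum>v\<in>S. s v)] (mod int p)"
    by (intro cong_add cong_refl cong_sum) (simp add: c(2) cong_def)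
  also have "[fixed + (\<Sum>v\<in>S. s v) = fixed + - fixed] (mod int p)" by (intro cong_add cong_refl s(2))
  finally have "[(\<Sum>e\<in>E. f (\<phi> c ` e)) = 0] (mod int p)" unfolding total by simp
  then show ?thesis unfolding zero_sum_embedding_def using inj[OF c(1)] sub[OF c(1)] by blast
qed

end

lemma disjoint_subsets_of_sizes:
  fixes k :: "'i \<Rightarrow> nat"
  assumes "finite I" "finite P" "(\<Sum>i\<in>I. k i) \<le> card P"
  obtains B where "\<And>i. i \<in> I \<Longrightarrow> B i \<subseteq> P" "\<And>i. i \<in> I \<Longrightarrow> card (B i) = k i"
    "\<And>i j. i \<in> I \<Longrightarrow> j \<in> I \<Longrightarrow> i \<noteq> j \<Longrightarrow> B i \<inter> B j = {}"
proof -
  have "\<exists>B. (\<forall>i\<in>I. B i \<subseteq> P \<and> card (B i) = k i) \<and> (\<forall>i\<in>I. \<forall>j\<in>I. i \<noteq> j \<longrightarrow> B i \<inter> B j = {})"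
    using assms
  proof (induction I arbitrary: P rule: finite_induct)
    case (insert i I)
    have ki: "k i + (\<Sum>i\<in>I. k i) \<le> card P" using insert.prems(2) sum.insert[OF insert.hyps, of k] by linarith
    then have "k i \<le> card P" by linarith
    then obtain C where C: "C \<subseteq> P" "card C = k i" by (rule obtain_subset_with_card_n)
    have "card (P - C) = card P - k i"
      using C insert.prems(1) finite_subset[of C P] by (simp add: card_Diff_subset)
    then have "(\<Sum>i\<in>I. k i) \<le> card (P - C)" using ki by linarith
    then obtain B where B: "\<forall>i\<in>I. B i \<subseteq> P - C \<and> card (B i) = k i"
      "\<forall>i\<in>I. \<forall>j\<in>I. i \<noteq> j \<longrightarrow> B i \<inter> B j = {}"
      using insert.IH[of "P - C"] insert.prems by blast
    let ?B = "B(i := C)"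
    have "\<forall>j\<in>insert i I. ?B j \<subseteq> P \<and> card (?B j) = k j"
      using B(1) C by auto
    moreover have "C \<inter> B j = {}" if "j \<in> I" for j using B(1) that by blast
    then have "\<forall>j\<in>insert i I. \<forall>j'\<in>insert i I. j \<noteq> j' \<longrightarrow> ?B j \<inter> ?B j' = {}"
      using B(2) by (simp add: Int_commute)
    ultimately show ?case by (intro exI[of _ ?B] conjI)
  qed simp
  then obtain B where B: "\<forall>i\<in>I. B i \<subseteq> P \<and> card (B i) = k i"
    "\<forall>i\<in>I. \<forall>j\<in>I. i \<noteq> j \<longrightarrow> B i \<inter> B j = {}" by (elim exE conjE)
  show thesis by (rule that[of B]) (use B in auto)
qed

context residue_colouring
begin

lemma zero_sum_embedding_mono:
  "zero_sum_embedding V E P \<Longrightarrow> P \<subseteq> Q \<Longrightarrow> zero_sum_embedding V E Q"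
  unfolding zero_sum_embedding_def by (meson order_trans)

section \<open>Matchings whose edges avoid one colour\<close>

definition off_matching :: "int \<Rightarrow> 'b set \<Rightarrow> 'b set set \<Rightarrow> bool" where
  "off_matching b P M \<longleftrightarrow> M \<subseteq> [P]\<^bsup>2\<^esup> \<and> (\<forall>e\<in>M. f e \<noteq> b) \<and> pairwise disjnt M"

lemma off_matching_edge:
  assumes "off_matching b P M" "e \<in> M"
  shows "e \<subseteq> P" "card e = 2" "f e \<noteq> b"
  using assms unfolding off_matching_def nsets_def by auto

lemma off_matching_disjoint:
  "off_matching b P M \<Longrightarrow> e \<in> M \<Longrightarrow> e' \<in> M \<Longrightarrow> e \<noteq> e' \<Longrightarrow> e \<inter> e' = {}"
  unfolding off_matching_def pairwise_def disjnt_def by blast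

lemma off_matching_finite: "off_matching b P M \<Longrightarrow> finite P \<Longrightarrow> finite M"
  unfolding off_matching_def using finite_subset[OF _ finite_imp_finite_nsets[of P 2]] by blast

lemma card_off_matching_vertices:
  assumes M: "off_matching b P M" and "finite P"
  shows "card (\<Union>M) = 2 * card M"
proof -
  have "card (\<Union>M) = (\<Sum>e\<in>M. card e)"
  proof (rule card_Union_disjoint)
    show "pairwise disjnt M" using M unfolding off_matching_def by blast
    show "finite e" if "e \<in> M" for e using off_matching_edge(1)[OF M that] assms(2) finite_subset by blast
  qed
  also have "\<dots> = (\<Sum>e\<in>M. 2)" using off_matching_edge(2)[OF M] by (intro sum.cong) auto
  finally show ?thesis by simp
qed

text \<open>A maximum matching cannot be augmented along an edge, so one end of each matching edge
  is joined to at most one uncovered vertex by an edge of a colour other than \<open>b\<close>.\<close>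

lemma maximum_off_matching_end:
  assumes P: "finite P" and M: "off_matching b P M"
    and max: "\<And>M'. off_matching b P M' \<Longrightarrow> card M' \<le> card M" and e: "e \<in> M"
  shows "\<exists>y\<in>e. \<exists>z. \<forall>t\<in>P - \<Union>M. f {y, t} \<noteq> b \<longrightarrow> t = z"
proof (rule ccontr)
  assume no: "\<not> ?thesis"
  obtain x y where xy: "e = {x, y}" "x \<noteq> y" using off_matching_edge(2)[OF M e] unfolding card_2_iff by blast
  obtain t1 where t1: "t1 \<in> P - \<Union>M" "f {x, t1} \<noteq> b" using no xy(1) by blast
  \<comment> \<open>The negated claim is used at \<open>y\<close> with \<open>z\<close> replaced by
    \<open>t1\<close>, which makes \<open>t2\<close> different from \<open>t1\<close>.\<close>
  obtain t2 where t2: "t2 \<in> P - \<Union>M" "f {y, t2} \<noteq> b" "t2 \<noteq> t1" using no xy(1) by blast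
  have exy: "x \<in> \<Union>M" "y \<in> \<Union>M" "x \<in> P" "y \<in> P" using e xy off_matching_edge(1)[OF M e] by auto
  have ne: "x \<noteq> t1" "y \<noteq> t2" "x \<noteq> t2" "y \<noteq> t1" using t1 t2 exy by auto
  define M0 where "M0 = M - {e}"
  define M' where "M' = insert {x, t1} (insert {y, t2} M0)"
  have M0: "M0 \<subseteq> M" unfolding M0_def by blast
  have disj0: "e' \<inter> {x, y, t1, t2} = {}" if "e' \<in> M0" for e'
  proof -
    have "e' \<inter> e = {}" using that off_matching_disjoint[OF M _ e] unfolding M0_def by blast
    then show ?thesis using t1 t2 that M0 xy by blast
  qed
  have "off_matching b P M'"
    unfolding off_matching_def
  proof (intro conjI)
    show "M' \<subseteq> [P]\<^bsup>2\<^esup>"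
      using M M0 ne exy t1 t2 unfolding M'_def off_matching_def nsets_def by auto
    show "\<forall>e\<in>M'. f e \<noteq> b" using M M0 t1 t2 unfolding M'_def off_matching_def by blast
    have 1: "{x, t1} \<inter> {y, t2} = {}" using ne xy t2 by auto
    have "pairwise disjnt M0"
      using M M0 unfolding off_matching_def by (meson pairwise_subset)
    moreover have "disjnt {x, t1} h" "disjnt {y, t2} h" if "h \<in> M0" for h
      using disj0[OF that] unfolding disjnt_def by blast+
    ultimately show "pairwise disjnt M'"
      using 1 unfolding M'_def pairwise_insert by (auto simp: disjnt_sym disjnt_def)
  qed
  moreover have "card M' = card M + 1"
  proof -
    have fM: "finite M" using off_matching_finite[OF M P] .
    have "{y, t2} \<notin> M0" "{x, t1} \<notin> insert {y, t2} M0"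
      using disj0[of "{y, t2}"] disj0[of "{x, t1}"] ne xy by (auto simp: doubleton_eq_iff)
    then have "card M' = card M0 + 2" unfolding M'_def M0_def using fM by simp
    moreover have "card M = card M0 + 1"
      unfolding M0_def using fM e by (metis Suc_eq_plus1 card.remove)
    ultimately show ?thesis by simp
  qed
  ultimately show False using max by fastforce
qed

text \<open>By maximality the uncovered points span only colour \<open>b\<close>, and each occupied
  end \<open>y e\<close> has at most one bad partner \<open>z e\<close> among them. A vertex outside
  \<open>S0\<close> has at most one neighbour in \<open>S0\<close>, hence at most one forbidden
  place. With \<open>k\<close> matching edges at least \<open>card V + p - 1 - 2 * k\<close> points
  are uncovered, more than the \<open>card V - k\<close> vertices to be placed, because
  \<open>k < p - 1\<close>. The copy has sum \<open>card E * b\<close>, which vanishes.\<close>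

lemma zero_sum_embedding_small_matchings:
  assumes G: "simple_graph V E" and dvd: "p dvd card E"
    and S: "two_packing V E S" "card S = p - 1"
    and P: "finite P" "card P \<ge> card V + p - 1"
    and small: "\<And>M. off_matching b P M \<Longrightarrow> card M < p - 1"
  shows "zero_sum_embedding V E P"
proof -
  have fV: "finite V" using G unfolding simple_graph_def by blast
  have SV: "S \<subseteq> V" using two_packing_subset[OF S(1)] .
  have fS: "finite S" using SV fV finite_subset by blast
  have "off_matching b P {}" unfolding off_matching_def by simp
  then obtain M where M: "off_matching b P M" and max: "\<And>M'. off_matching b P M' \<Longrightarrow> card M' \<le> card M"
    using ex_has_greatest_nat[of "off_matching b P" "{}" card "p - 1"] small by blast
  have fM: "finite M" using off_matching_finite[OF M P(1)] .
  have sub: "\<Union>M \<subseteq> P" using off_matching_edge(1)[OF M] by blast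
  define I where "I = P - \<Union>M"
  have "\<forall>e\<in>M. \<exists>y. \<exists>z. y \<in> e \<and> (\<forall>t\<in>I. f {y, t} \<noteq> b \<longrightarrow> t = z)"
    using maximum_off_matching_end[OF P(1) M max] unfolding I_def by blast
  then obtain y z where yz: "\<And>e. e \<in> M \<Longrightarrow> y e \<in> e"
    "\<And>e t. e \<in> M \<Longrightarrow> t \<in> I \<Longrightarrow> f {y e, t} \<noteq> b \<Longrightarrow> t = z e" by metis
  have "card M \<le> card S" using small[OF M] S(2) by simp
  then obtain S0 where S0: "S0 \<subseteq> S" "card S0 = card M" "finite S0" by (rule obtain_subset_with_card_n)
  obtain \<beta> where \<beta>: "bij_betw \<beta> S0 M" using finite_same_card_bij[OF S0(3) fM S0(2)] by blast
  have \<beta>M: "\<beta> v \<in> M" if "v \<in> S0" for v using \<beta> that bij_betwE by blast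
  have ind: "{u, v} \<notin> E" if "u \<in> S0" "v \<in> S0" for u v
    using two_packing_independent[OF G S(1)] that S0 by blast
  define own where "own u = (SOME v. v \<in> S0 \<and> u \<in> nbhd E v)" for u
  have own: "own u = v" if "v \<in> S0" "u \<in> nbhd E v" for u v
    unfolding own_def
    by (rule some_equality) (use that S0(1) two_packing_nbhd_disjoint[OF S(1)] in blast)+
  have fI: "finite I" unfolding I_def using P by simp
  have "card I = card P - 2 * card M"
    unfolding I_def using card_off_matching_vertices[OF M P(1)] sub P(1)
    by (intro trans[OF card_Diff_subset]) (auto intro: finite_subset)
  moreover have "card (V - S0) = card V - card M"
    using S0 SV by (simp add: card_Diff_subset)
  moreover have "card M \<le> card V" using S0 SV fV by (metis card_mono order_trans)
  ultimately have "card (V - S0) < card I" using P(2) small[OF M] by linarith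
  then obtain g where g: "inj_on g (V - S0)" "g ` (V - S0) \<subseteq> I" "\<And>w. w \<in> V - S0 \<Longrightarrow> g w \<noteq> z (\<beta> (own w))"
    using injection_avoiding[of "V - S0" I "\<lambda>w. z (\<beta> (own w))"] fV fI by blast
  define \<phi> where "\<phi> v = (if v \<in> S0 then y (\<beta> v) else g v)" for v
  have \<phi>1: "\<phi> v = y (\<beta> v)" "\<phi> v \<in> \<Union>M" if "v \<in> S0" for v
    using that yz(1)[OF \<beta>M[OF that]] \<beta>M[OF that] unfolding \<phi>_def by auto
  have \<phi>2: "\<phi> v = g v" "\<phi> v \<in> I" if "v \<in> V - S0" for v
    using that g(2) unfolding \<phi>_def by auto
  have inj1: "inj_on \<phi> S0"
  proof (rule inj_onI)
    fix u v assume uv: "u \<in> S0" "v \<in> S0" "\<phi> u = \<phi> v"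
    then have "\<beta> u \<inter> \<beta> v \<noteq> {}" using \<phi>1(1) yz(1) \<beta>M by (metis disjoint_iff)
    then have "\<beta> u = \<beta> v" using off_matching_disjoint[OF M] \<beta>M uv by blast
    then show "u = v" using \<beta> uv unfolding bij_betw_def inj_on_def by blast
  qed
  have inj2: "inj_on \<phi> (V - S0)" using g(1) \<phi>2(1) inj_on_cong by blast
  have inj: "inj_on \<phi> V"
  proof (rule inj_onI)
    fix u v assume uv: "u \<in> V" "v \<in> V" "\<phi> u = \<phi> v"
    have "u \<in> S0 \<longleftrightarrow> v \<in> S0"
      using \<phi>1(2)[of u] \<phi>1(2)[of v] \<phi>2(2)[of u] \<phi>2(2)[of v] uv unfolding I_def by auto
    then show "u = v" using inj1 inj2 uv unfolding inj_on_def by blast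
  qed
  have im: "\<phi> ` V \<subseteq> P"
  proof
    fix t assume "t \<in> \<phi> ` V"
    then obtain v where "v \<in> V" "t = \<phi> v" by blast
    then show "t \<in> P" using \<phi>1(2)[of v] \<phi>2(2)[of v] sub unfolding I_def by blast
  qed
  have mixed: "f {\<phi> u, \<phi> v} = b" if u: "u \<in> S0" and v: "v \<in> V - S0" and uv: "{u, v} \<in> E" for u v
  proof (rule ccontr)
    assume "f {\<phi> u, \<phi> v} \<noteq> b"
    then have "\<phi> v = z (\<beta> u)" using yz(2)[OF \<beta>M[OF u] \<phi>2(2)[OF v]] \<phi>1(1)[OF u] by simp
    moreover have "own v = u" by (rule own[OF u]) (use uv in \<open>simp add: nbhd_def\<close>)
    ultimately show False using g(3)[OF v] \<phi>2(1)[OF v] by simp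
  qed
  have outer: "f {\<phi> u, \<phi> v} = b" if u: "u \<in> V - S0" and v: "v \<in> V - S0" and uv: "u \<noteq> v" for u v
  proof (rule ccontr)
    assume off: "f {\<phi> u, \<phi> v} \<noteq> b"
    have ne: "\<phi> u \<noteq> \<phi> v" using inj u v uv unfolding inj_on_def by blast
    have I: "\<phi> u \<in> I" "\<phi> v \<in> I" using \<phi>2(2) u v by auto
    have "off_matching b P (insert {\<phi> u, \<phi> v} M)"
      using M off ne I unfolding off_matching_def I_def nsets_def pairwise_insert
      by (auto simp: disjnt_def)
    moreover have "{\<phi> u, \<phi> v} \<notin> M" using I unfolding I_def by blast
    ultimately show False using max fM by fastforce
  qed
  have "f (\<phi> ` e) = b" if eE: "e \<in> E" for e
  proof -
    obtain u v where e: "e = {u, v}" "u \<noteq> v" "u \<in> V" "v \<in> V" using simple_graph_edgeE[OF G eE] .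
    have "\<not> (u \<in> S0 \<and> v \<in> S0)" using ind eE e by blast
    then have "f {\<phi> u, \<phi> v} = b"
      using mixed[of u v] mixed[of v u] outer[of u v] e eE by (cases "u \<in> S0"; cases "v \<in> S0") (auto simp: insert_commute)
    then show ?thesis using e by simp
  qed
  then have "(\<Sum>e\<in>E. f (\<phi> ` e)) = int (card E) * b" by simp
  then have "[(\<Sum>e\<in>E. f (\<phi> ` e)) = 0] (mod int p)" using dvd by (simp add: cong_0_iff)
  then show ?thesis unfolding zero_sum_embedding_def using inj im by blast
qed

text \<open>The congruence compares the two pairs of opposite edges of the 4-cycle \<open>x\<close>,
  \<open>a\<close>, \<open>y\<close>, \<open>c\<close>; its alternating sum must not vanish.\<close>

definition crossed :: "'b \<Rightarrow> 'b \<Rightarrow> 'b \<Rightarrow> 'b \<Rightarrow> bool" where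
  "crossed x y a c \<longleftrightarrow> distinct [x, y, a, c] \<and>
     \<not> [f {x, a} + f {y, c} = f {y, a} + f {x, c}] (mod int p)"

text \<open>Fix \<open>r\<close>. The defect \<open>K x a = f {x, a} - f {x, r} - f {a, r}\<close>
  does not depend on \<open>a\<close>, by the cycle \<open>x\<close>, \<open>a\<close>,
  \<open>r\<close>, \<open>c\<close>; by symmetry it is a constant \<open>\<kappa>\<close> off
  \<open>r\<close>. So \<open>h x = f {x, r}\<close> works off \<open>r\<close>, and
  \<open>h r = - \<kappa>\<close> corrects the edges at \<open>r\<close>. Keeping
  \<open>\<kappa>\<close> apart from \<open>h\<close> avoids a division by two, so that
  \<open>p = 2\<close> is covered.\<close>

lemma additive_if_no_crossed:
  assumes none: "\<And>x y a c. x \<in> R \<Longrightarrow> y \<in> R \<Longrightarrow> a \<in> R \<Longrightarrow> c \<in> R \<Longrightarrow> \<not> crossed x y a c"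
  obtains h \<kappa> where "\<And>x y. x \<in> R \<Longrightarrow> y \<in> R \<Longrightarrow> x \<noteq> y \<Longrightarrow> [f {x, y} = h x + h y + \<kappa>] (mod int p)"
proof (cases "\<exists>r s t. r \<in> R \<and> s \<in> R \<and> t \<in> R \<and> distinct [r, s, t]")
  case False
  show thesis
  proof (cases "\<exists>r s. r \<in> R \<and> s \<in> R \<and> r \<noteq> s")
    case True
    then obtain r s where rs: "r \<in> R" "s \<in> R" "r \<noteq> s" by blast
    have R: "R = {r, s}" using False rs by auto
    show thesis
    proof (rule that[of "\<lambda>_. 0" "f {r, s}"])
      fix x y assume "x \<in> R" "y \<in> R" "x \<noteq> y"
      then have "{x, y} = {r, s}" using R by auto
      then show "[f {x, y} = 0 + 0 + f {r, s}] (mod int p)" by simp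
    qed
  qed (use that in blast)
next
  case True
  then obtain r s t where rst: "r \<in> R" "s \<in> R" "t \<in> R" "distinct [r, s, t]" by blast
  define K where "K x a = f {x, a} - f {x, r} - f {a, r}" for x a
  define h where "h x = (if x = r then - K s t else f {x, r})" for x
  have sym: "K x a = K a x" for x a unfolding K_def by (simp add: insert_commute)
  have step: "[K x a = K x c] (mod int p)"
    if "x \<in> R" "a \<in> R" "c \<in> R" "x \<noteq> r" "a \<noteq> r" "c \<noteq> r" "x \<noteq> a" "x \<noteq> c" for x a c
  proof (cases "a = c")
    case False
    then have "distinct [x, r, a, c]" using that by auto
    then have "[f {x, a} + f {r, c} = f {r, a} + f {x, c}] (mod int p)"
      using none[of x r a c] that rst(1) unfolding crossed_def by blast
    then have "[(f {x, a} + f {r, c}) + (- f {x, r} - f {a, r} - f {c, r}) =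
        (f {r, a} + f {x, c}) + (- f {x, r} - f {a, r} - f {c, r})] (mod int p)"
      by (simp only: cong_add_rcancel)
    then show ?thesis unfolding K_def by (simp add: insert_commute algebra_simps)
  qed simp
  have K: "[K x a = K s t] (mod int p)"
    if xa: "x \<in> R" "a \<in> R" "x \<noteq> r" "a \<noteq> r" "x \<noteq> a" for x a
  proof -
    have at_s: "[K s u = K s t] (mod int p)" if "u \<in> R" "u \<noteq> r" "u \<noteq> s" for u
      using step[of s u t] that rst by auto
    show ?thesis
    proof (cases "x = s")
      case True
      then show ?thesis using at_s xa by auto
    next
      case xs: False
      show ?thesis
      proof (cases "a = s")
        case True
        then show ?thesis using at_s[of x] xa sym by metis
      next
        case False
        then have "[K x a = K s x] (mod int p)" using step[of x a s] xa xs rst sym by auto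
        then show ?thesis using at_s[of x] xa xs cong_trans by blast
      qed
    qed
  qed
  show thesis
  proof (rule that[of h "K s t"])
    fix x y assume xy: "x \<in> R" "y \<in> R" "x \<noteq> y"
    consider "x = r" | "y = r" | "x \<noteq> r" "y \<noteq> r" by blast
    then show "[f {x, y} = h x + h y + K s t] (mod int p)"
    proof cases
      case 1
      then show ?thesis using xy unfolding h_def by (simp add: insert_commute)
    next
      case 2
      then show ?thesis using xy unfolding h_def by (simp add: insert_commute)
    next
      case 3
      have "[f {x, r} + f {y, r} + K x y = f {x, r} + f {y, r} + K s t] (mod int p)"
        by (intro cong_add cong_refl K) (use xy 3 in auto)
      then show ?thesis using 3 unfolding h_def K_def by simp
    qed
  qed
qed

text \<open>Consider the sums from \<open>x\<close> and from \<open>y\<close> to \<open>B\<close>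
  together with \<open>a\<close>, and to \<open>B\<close> together with \<open>c\<close>. If both
  pairs balanced, combining the two congruences would cancel \<open>B\<close> and leave the one
  excluded by \<open>crossed\<close>.\<close>

lemma gadget_from_crossed:
  assumes cr: "crossed x y a c" and B: "finite B" "card B = d - 1" "d \<ge> 1" "B \<inter> {x, y, a, c} = {}"
  shows "\<exists>X. X \<subseteq> {x, y, a, c} \<union> B \<and> gadget d X"
proof (rule ccontr)
  assume no: "\<not> ?thesis"
  have dist: "x \<noteq> y" "x \<noteq> a" "x \<noteq> c" "y \<noteq> a" "y \<noteq> c" "a \<noteq> c" using cr unfolding crossed_def by auto
  have *: "[f {x, s} + (\<Sum>u\<in>B. f {x, u}) = f {y, s} + (\<Sum>u\<in>B. f {y, u})] (mod int p)"
    if s: "s \<in> {a, c}" for s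
  proof (rule ccontr)
    assume neq: "\<not> ?thesis"
    have sB: "s \<notin> B" using s B by blast
    have "gadget d (insert x (insert y (insert s B)))"
      by (rule gadgetI) (use neq sB s B dist in auto)
    moreover have "insert x (insert y (insert s B)) \<subseteq> {x, y, a, c} \<union> B" using s by blast
    ultimately show False using no by blast
  qed
  let ?u = "\<Sum>u\<in>B. f {x, u}" and ?v = "\<Sum>u\<in>B. f {y, u}"
  have "[(f {x, a} + ?u) + (f {y, c} + ?v) + (- ?u - ?v) = (f {y, a} + ?v) + (f {x, c} + ?u) + (- ?u - ?v)] (mod int p)"
    by (rule cong_add[OF cong_add[OF *[of a] cong_sym[OF *[of c]]] cong_refl]) simp_all
  then show False using cr unfolding crossed_def by (simp add: algebra_simps)
qed

text \<open>If there are \<open>p - 1\<close> disjoint cycles, each centre \<open>v\<close> takes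
  one of them and \<open>vertex_degree E v - 1\<close> further points as padding. Outside the cycles
  at least \<open>card V + p - 4\<close> points remain, and the padding needs at most
  \<open>card V - 2 * (p - 1)\<close>, because the closed neighbourhoods are disjoint. With fewer
  cycles, a maximal family leaves an additive colouring on at least \<open>card V + p - 1\<close>
  points.\<close>

lemma zero_sum_embedding_large:
  assumes G: "simple_graph V E" and dvd: "p dvd card E"
    and S: "two_packing V E S" "card S = p - 1" and deg: "\<And>v. v \<in> S \<Longrightarrow> vertex_degree E v \<ge> 1"
    and P: "finite P" "card P \<ge> card V + 5 * p - 8"
  shows "zero_sum_embedding V E P"
proof -
  have p2: "p \<ge> 2" using prime_p by (rule prime_ge_2_nat)
  have fV: "finite V" using G unfolding simple_graph_def by blast
  have fS: "finite S" using two_packing_subset[OF S(1)] fV finite_subset by blast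
  define good where "good \<Q> \<longleftrightarrow> (\<forall>Q\<in>\<Q>. Q \<subseteq> P \<and> (\<exists>x y a c. Q = {x, y, a, c} \<and> crossed x y a c)) \<and>
    (\<forall>Q\<in>\<Q>. \<forall>Q'\<in>\<Q>. Q \<noteq> Q' \<longrightarrow> Q \<inter> Q' = {})" for \<Q>
  have good_finite: "finite \<Q>" "card \<Q> < Suc (card (Pow P))" if "good \<Q>" for \<Q>
  proof -
    have "\<Q> \<subseteq> Pow P" using that unfolding good_def by blast
    then show "finite \<Q>" "card \<Q> < Suc (card (Pow P))" using P(1) by (auto intro: finite_subset simp: less_Suc_eq_le simp del: card_Pow intro!: card_mono)
  qed
  have "good {}" unfolding good_def by blast
  then obtain \<Q> where \<Q>: "good \<Q>" and max: "\<And>\<Q>'. good \<Q>' \<Longrightarrow> card \<Q>' \<le> card \<Q>"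
    using ex_has_greatest_nat[of good "{}" card "Suc (card (Pow P))"] good_finite(2) by blast
  have \<Q>P: "Q \<subseteq> P" and \<Q>cr: "\<exists>x y a c. Q = {x, y, a, c} \<and> crossed x y a c" if "Q \<in> \<Q>" for Q
    using \<Q> that unfolding good_def by simp_all
  have \<Q>disj: "Q \<inter> Q' = {}" if "Q \<in> \<Q>" "Q' \<in> \<Q>" "Q \<noteq> Q'" for Q Q'
    using \<Q> that unfolding good_def by simp
  have card4: "card Q = 4" if "Q \<in> \<Q>" for Q
    using \<Q>cr[OF that] unfolding crossed_def by auto
  have fQ: "finite Q" if "Q \<in> \<Q>" for Q using card4[OF that] card.infinite by fastforce
  show ?thesis
  proof (cases "card \<Q> \<ge> p - 1")
    case True
    then obtain \<Q>0 where \<Q>0: "\<Q>0 \<subseteq> \<Q>" "card \<Q>0 = p - 1" by (rule obtain_subset_with_card_n)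
    have f0: "finite \<Q>0" using good_finite(1)[OF \<Q>] \<Q>0 finite_subset by blast
    obtain q where q: "bij_betw q S \<Q>0" using finite_same_card_bij[OF fS f0] S \<Q>0 by metis
    have qQ: "q v \<in> \<Q>" if "v \<in> S" for v using q that \<Q>0 bij_betwE by blast
    have qdisj: "q u \<inter> q v = {}" if "u \<in> S" "v \<in> S" "u \<noteq> v" for u v
      using \<Q>disj qQ that q unfolding bij_betw_def inj_on_def by metis
    have "\<forall>v\<in>S. \<exists>x y a c. q v = {x, y, a, c} \<and> crossed x y a c"
      using \<Q>cr qQ by simp
    then obtain x y a c where cr: "\<And>v. v \<in> S \<Longrightarrow> q v = {x v, y v, a v, c v}"
      "\<And>v. v \<in> S \<Longrightarrow> crossed (x v) (y v) (a v) (c v)" by metis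
    define P0 where "P0 = P - \<Union>(q ` S)"
    have qP: "\<Union>(q ` S) \<subseteq> P" using \<Q>P qQ by blast
    have "card (\<Union>(q ` S)) = (\<Sum>v\<in>S. card (q v))"
      by (rule card_UN_disjoint) (use fS fQ qQ qdisj in auto)
    also have "\<dots> = 4 * (p - 1)" using card4 qQ S(2) by simp
    finally have cardP0: "card P0 = card P - 4 * (p - 1)"
      unfolding P0_def using qP P(1) card_Diff_subset[OF finite_subset[OF qP P(1)] qP] by simp
    have "(\<Sum>v\<in>S. vertex_degree E v - 1) + 2 * (p - 1) = (\<Sum>v\<in>S. (vertex_degree E v - 1) + 2)"
      using S(2) by (simp add: sum.distrib del: add_2_eq_Suc')
    also have "\<dots> = (\<Sum>v\<in>S. vertex_degree E v + 1)" using deg by (intro sum.cong) force+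
    also have "\<dots> = card (\<Union>v\<in>S. closed_nbhd E v)" using card_packing_union[OF G S(1) order.refl] by simp
    also have "\<dots> \<le> card V" using packing_union_subset[OF G S(1)] fV card_mono by blast
    finally have "(\<Sum>v\<in>S. vertex_degree E v - 1) \<le> card P0" using cardP0 P(2) p2 by linarith
    then obtain B where B: "\<And>v. v \<in> S \<Longrightarrow> B v \<subseteq> P0" "\<And>v. v \<in> S \<Longrightarrow> card (B v) = vertex_degree E v - 1"
      "\<And>u v. u \<in> S \<Longrightarrow> v \<in> S \<Longrightarrow> u \<noteq> v \<Longrightarrow> B u \<inter> B v = {}"
      using disjoint_subsets_of_sizes[OF fS, of P0 "\<lambda>v. vertex_degree E v - 1"] P(1) unfolding P0_def by blast
    have "\<forall>v\<in>S. \<exists>X. X \<subseteq> q v \<union> B v \<and> gadget (vertex_degree E v) X"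
    proof
      fix v assume v: "v \<in> S"
      have "finite (B v)" using B(1)[OF v] P(1) finite_subset unfolding P0_def by blast
      moreover have "B v \<inter> {x v, y v, a v, c v} = {}" using B(1)[OF v] cr(1)[OF v] v unfolding P0_def by blast
      ultimately show "\<exists>X. X \<subseteq> q v \<union> B v \<and> gadget (vertex_degree E v) X"
        unfolding cr(1)[OF v] using gadget_from_crossed[OF cr(2)[OF v]] B(2)[OF v] deg[OF v] by blast
    qed
    then obtain X where X: "\<And>v. v \<in> S \<Longrightarrow> X v \<subseteq> q v \<union> B v" "\<And>v. v \<in> S \<Longrightarrow> gadget (vertex_degree E v) (X v)"
      by metis
    show ?thesis
    proof (rule zero_sum_embedding_gadgets[OF G S P(1)])
      show "card V + p - 1 \<le> card P" using P(2) p2 by linarith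
      show "X v \<subseteq> P" if "v \<in> S" for v using X(1)[OF that] B(1)[OF that] qP that unfolding P0_def by blast
      show "X u \<inter> X v = {}" if uv: "u \<in> S" "v \<in> S" "u \<noteq> v" for u v
      proof -
        have "q u \<inter> B v = {}" "q v \<inter> B u = {}" using B(1) uv unfolding P0_def by blast+
        then have "(q u \<union> B u) \<inter> (q v \<union> B v) = {}" using qdisj[OF uv] B(3)[OF uv] by blast
        then show ?thesis using X(1)[OF uv(1)] X(1)[OF uv(2)] by blast
      qed
    qed (rule X(2))
  next
    case False
    define R where "R = P - \<Union>\<Q>"
    have "\<not> crossed x y a c" if "x \<in> R" "y \<in> R" "a \<in> R" "c \<in> R" for x y a c
    proof
      assume cr: "crossed x y a c"
      have "good (insert {x, y, a, c} \<Q>)"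
        unfolding good_def
      proof (intro conjI ballI impI)
        fix Q assume "Q \<in> insert {x, y, a, c} \<Q>"
        then show "Q \<subseteq> P" "\<exists>x y a c. Q = {x, y, a, c} \<and> crossed x y a c"
          using \<Q>P \<Q>cr cr that unfolding R_def by blast+
      next
        have new: "{x, y, a, c} \<inter> Q = {}" if "Q \<in> \<Q>" for Q
          using that \<open>x \<in> R\<close> \<open>y \<in> R\<close> \<open>a \<in> R\<close> \<open>c \<in> R\<close> unfolding R_def by blast
        fix Q Q' assume "Q \<in> insert {x, y, a, c} \<Q>" "Q' \<in> insert {x, y, a, c} \<Q>" "Q \<noteq> Q'"
        then show "Q \<inter> Q' = {}" using new[of Q] new[of Q'] \<Q>disj[of Q Q'] by (metis Int_commute insertE)
      qed
      moreover have "{x, y, a, c} \<notin> \<Q>" using that unfolding R_def by blast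
      ultimately show False using max good_finite(1)[OF \<Q>] by fastforce
    qed
    then obtain h \<kappa> where h: "\<And>x y. x \<in> R \<Longrightarrow> y \<in> R \<Longrightarrow> x \<noteq> y \<Longrightarrow> [f {x, y} = h x + h y + \<kappa>] (mod int p)"
      using additive_if_no_crossed[of R] by blast
    have "card (\<Union>\<Q>) = (\<Sum>Q\<in>\<Q>. card Q)"
      by (rule card_Union_disjoint) (use \<Q>disj fQ in \<open>auto simp: pairwise_def disjnt_def\<close>)
    then have "card (\<Union>\<Q>) = 4 * card \<Q>" using card4 by simp
    moreover have "\<Union>\<Q> \<subseteq> P" using \<Q>P by blast
    ultimately have "card R = card P - 4 * card \<Q>"
      unfolding R_def using P(1) by (intro trans[OF card_Diff_subset]) (auto intro: finite_subset)
    then have "card R \<ge> card V + p - 1" using False P(2) by linarith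
    then have "zero_sum_embedding V E R"
      using zero_sum_embedding_additive[OF G dvd _ _ h] P(1) unfolding R_def by blast
    then show ?thesis by (rule zero_sum_embedding_mono) (simp add: R_def)
  qed
qed

section \<open>Maximal packings by gadgets\<close>

text \<open>Gadgets are indexed by positions in a list of degrees instead of by vertices, so that a
  partial packing serves an initial segment, here the smallest degrees.\<close>

definition gadget_packing :: "(nat \<Rightarrow> nat) \<Rightarrow> 'b set \<Rightarrow> nat \<Rightarrow> (nat \<Rightarrow> 'b set) \<Rightarrow> bool" where
  "gadget_packing d P m U \<longleftrightarrow> (\<forall>i<m. gadget (d i) (U i) \<and> U i \<subseteq> P) \<and>
     (\<forall>i<m. \<forall>j<m. i \<noteq> j \<longrightarrow> U i \<inter> U j = {})"

lemma gadget_packingD: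
  assumes "gadget_packing d P m U" "i < m"
  shows "gadget (d i) (U i)" "U i \<subseteq> P" "\<And>j. j < m \<Longrightarrow> i \<noteq> j \<Longrightarrow> U i \<inter> U j = {}"
  using assms unfolding gadget_packing_def by blast+

lemma gadget_packing_finite: "gadget_packing d P m U \<Longrightarrow> i < m \<Longrightarrow> finite (U i)"
  by (rule gadget_finite[OF gadget_packingD(1)])

lemma gadget_triple:
  assumes "x \<noteq> z" "y \<noteq> z" "x \<noteq> y" "f {x, z} \<noteq> f {y, z}"
  shows "gadget 1 {x, y, z}"
  by (rule gadgetI) (use assms colour_eqI in auto)

end

text \<open>A rest of \<open>d m + 3\<close> vertices without a gadget spans a single colour. For \<open>d m = 1\<close> gadgets are
  triples, and three vertices suffice; this is the case in which \<open>c = 0\<close> although \<open>S\<close> dominates the graph.\<close>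

locale maximal_packing = residue_colouring p f for p :: nat and f :: "'b set \<Rightarrow> int" +
  fixes P :: "'b set" and d :: "nat \<Rightarrow> nat" and m :: nat
  assumes finite_P: "finite P"
    and sorted: "\<And>i. i < m \<Longrightarrow> d i \<le> d m"
    and nonzero: "\<And>i. i \<le> m \<Longrightarrow> \<not> p dvd d i"
    and large: "card P \<ge> (\<Sum>i<m. d i + 2) + d m + 3 \<or> d m = 1 \<and> card P \<ge> (\<Sum>i<m. d i + 2) + 3"
    and maximal: "\<And>U. \<not> gadget_packing d P (Suc m) U"
begin

definition rest :: "(nat \<Rightarrow> 'b set) \<Rightarrow> 'b set" where
  "rest U = P - (\<Union>i<m. U i)"

lemma d_pos: "i \<le> m \<Longrightarrow> d i \<ge> 1"
  using nonzero[of i] by (cases "d i") auto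

lemma rest_subset: "rest U \<subseteq> P"
  unfolding rest_def by blast

lemma finite_rest: "finite (rest U)"
  using rest_subset finite_P finite_subset by blast

lemma rest_disjoint: "i < m \<Longrightarrow> U i \<inter> rest U = {}"
  unfolding rest_def by blast

lemma card_rest:
  assumes U: "gadget_packing d P m U"
  shows "card (rest U) \<ge> d m + 3 \<or> d m = 1 \<and> card (rest U) \<ge> 3"
proof -
  have "card (\<Union>i<m. U i) = (\<Sum>i<m. card (U i))"
    by (rule card_UN_disjoint) (use gadget_packingD(3)[OF U] gadget_packing_finite[OF U] in auto)
  also have "\<dots> = (\<Sum>i<m. d i + 2)"
    by (rule sum.cong) (use gadget_packingD(1)[OF U] gadget_card in auto)
  finally have "card (\<Union>i<m. U i) = (\<Sum>i<m. d i + 2)" .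
  moreover have sub: "(\<Union>i<m. U i) \<subseteq> P" using gadget_packingD(2)[OF U] by blast
  ultimately have "card (rest U) = card P - (\<Sum>i<m. d i + 2)"
    unfolding rest_def using card_Diff_subset[OF finite_subset[OF sub finite_P] sub] by simp
  then show ?thesis using large by linarith
qed

lemma card_rest_ge: "gadget_packing d P m U \<Longrightarrow> card (rest U) \<ge> 3"
  using card_rest by fastforce

text \<open>A gadget for \<open>d m\<close> in the rest would extend the packing, against
  \<open>maximal\<close>.\<close>

lemma rest_monochromatic:
  assumes U: "gadget_packing d P m U"
  obtains b where "monochromatic b (rest U)"
proof (rule monochromatic_if_no_gadget[OF finite_rest])
  show "\<not> p dvd d m" using nonzero by blast
  show "d m + 3 \<le> card (rest U) \<or> d m = 1 \<and> 3 \<le> card (rest U)" using card_rest[OF U] .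
  show "\<not> gadget (d m) X" if X: "X \<subseteq> rest U" for X
  proof
    assume gad: "gadget (d m) X"
    have "U i \<inter> X = {}" if "i < m" for i using rest_disjoint[OF that] X by blast
    then have "gadget_packing d P (Suc m) (U(m := X))"
      using gad gadget_packingD[OF U] X rest_subset[of U]
      unfolding gadget_packing_def by (auto simp: less_Suc_eq)
    then show False using maximal by blast
  qed
qed (use that in blast)

section \<open>Exchanging a gadget inside its union with the rest\<close>

lemma exchange:
  assumes U: "gadget_packing d P m U" and i: "i < m"
    and X: "X \<subseteq> U i \<union> rest U" "gadget (d i) X"
  shows "gadget_packing d P m (U(i := X))" "rest (U(i := X)) = (U i \<union> rest U) - X"
proof -
  have Xj: "X \<inter> U j = {}" if "j < m" "j \<noteq> i" for j
    using X(1) gadget_packingD(3)[OF U i that(1)] rest_disjoint[OF that(1)] that(2) by blast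
  have XP: "X \<subseteq> P" using X(1) gadget_packingD(2)[OF U i] rest_subset by blast
  show "gadget_packing d P m (U(i := X))"
    unfolding gadget_packing_def
  proof (intro conjI allI impI)
    fix j k assume jk: "j < m" "k < m" "j \<noteq> k"
    show "(U(i := X)) j \<inter> (U(i := X)) k = {}"
      using Xj[of j] Xj[of k] gadget_packingD(3)[OF U jk(1,2,3)] jk by (cases "j = i"; cases "k = i") auto
  qed (use gadget_packingD[OF U] X(2) XP in auto)
  have "(\<Union>j<m. (U(i := X)) j) = X \<union> (\<Union>j\<in>{..<m} - {i}. U j)" using i by auto
  then have "rest (U(i := X)) = P - X - (\<Union>j\<in>{..<m} - {i}. U j)" unfolding rest_def by blast
  moreover have "P - (\<Union>j\<in>{..<m} - {i}. U j) = U i \<union> rest U"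
  proof -
    have "U i \<inter> U j = {}" if "j \<in> {..<m} - {i}" for j using gadget_packingD(3)[OF U i] that by auto
    moreover have "(\<Union>j<m. U j) = U i \<union> (\<Union>j\<in>{..<m} - {i}. U j)" using i by auto
    ultimately show ?thesis unfolding rest_def using gadget_packingD(2)[OF U i] by blast
  qed
  ultimately show "rest (U(i := X)) = (U i \<union> rest U) - X" by blast
qed

text \<open>The only case in which the old and the new rest may share a single vertex: a packing by
  triples whose rest is a triple.\<close>

lemma exchange_colour_triples:
  assumes dist: "distinct [r, y, a, u, u1, u2]" and W: "W = {r, y, a, u, u1, u2}"
    and comp: "\<And>T. T \<subseteq> W \<Longrightarrow> gadget 1 T \<Longrightarrow> \<exists>c. monochromatic c (W - T)"
    and R: "monochromatic b {r, y, a}" and U: "gadget 1 {u, u1, u2}" and X: "gadget 1 {u, y, a}"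
    and R': "monochromatic c {r, u1, u2}"
  shows "b = c"
proof (rule ccontr)
  assume bc: "b \<noteq> c"
  have fR: "f {r, y} = b" "f {r, a} = b" "f {y, a} = b"
    using monochromaticD[OF R] dist by auto
  have fR': "f {u1, r} = c" "f {u2, r} = c" "f {u1, u2} = c"
    using monochromaticD[OF R'] dist by auto
  have mono: "f {q1, q2} = f {q1, q3} \<and> f {q1, q2} = f {q2, q3}"
    if gad: "gadget 1 {t1, t2, t3}" and W': "W = {t1, t2, t3, q1, q2, q3}"
      and dist': "distinct [t1, t2, t3, q1, q2, q3]"
    for t1 t2 t3 q1 q2 q3
  proof -
    have "W - {t1, t2, t3} = {q1, q2, q3}" unfolding W' using dist' by auto
    moreover have "{t1, t2, t3} \<subseteq> W" unfolding W' by blast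
    ultimately obtain g where "monochromatic g {q1, q2, q3}" using comp[OF _ gad] by metis
    then show ?thesis using dist' unfolding monochromatic_def by auto
  qed
  have yr: "f {y, r} = b" and ar: "f {a, r} = b" using fR by (simp_all add: insert_commute)
  \<comment> \<open>If \<open>b\<close> and \<open>c\<close> differ, a triple consisting of
    \<open>r\<close>, a point of the old rest and a point of the new rest is a gadget. The
    complements of three such triples determine the colours around \<open>u\<close>.\<close>
  have g1: "gadget 1 {u1, y, r}" "gadget 1 {u1, a, r}" "gadget 1 {u2, y, r}" "gadget 1 {u2, a, r}"
    by (rule gadget_triple; use dist fR' yr ar bc in auto)+
  have 1: "f {a, u} = f {a, u2} \<and> f {a, u} = f {u, u2}"
    by (rule mono[OF g1(1)]) (use dist in \<open>auto simp: W\<close>)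
  have 2: "f {y, u} = f {y, u2} \<and> f {y, u} = f {u, u2}"
    by (rule mono[OF g1(2)]) (use dist in \<open>auto simp: W\<close>)
  have 3: "f {a, u} = f {a, u1} \<and> f {a, u} = f {u, u1}"
    by (rule mono[OF g1(3)]) (use dist in \<open>auto simp: W\<close>)
  define e where "e = f {u, u2}"
  have e: "f {a, u} = e" "f {y, u} = e" "f {a, u2} = e" "f {u, u1} = e" "f {u, u2} = e"
    using 1 2 3 unfolding e_def by auto
  have "e \<noteq> c"
  proof
    assume "e = c"
    then have "monochromatic c {u, u1, u2}" unfolding monochromatic_def using e fR'(3) by (auto simp: insert_commute)
    then show False using U monochromatic_not_gadget by blast
  qed
  have "e \<noteq> b"
  proof
    assume "e = b"
    then have "monochromatic b {u, y, a}" unfolding monochromatic_def using e fR(3) by (auto simp: insert_commute)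
    then show False using X monochromatic_not_gadget by blast
  qed
  \<comment> \<open>The complement of the gadget \<open>{u, r, y}\<close> is
    \<open>{a, u1, u2}\<close>. It would have a single colour, although \<open>{a, u2}\<close> has
    colour \<open>e\<close> and \<open>{u1, u2}\<close> has colour \<open>c\<close>.\<close>
  then have "f {u, y} \<noteq> f {r, y}" using e(2) fR(1) by (simp add: insert_commute)
  then have "gadget 1 {u, r, y}" by (intro gadget_triple) (use dist in auto)
  then have "f {a, u1} = f {a, u2} \<and> f {a, u1} = f {u1, u2}" by (rule mono) (use dist in \<open>auto simp: W\<close>)
  then show False using e(3) fR'(3) \<open>e \<noteq> c\<close> by simp
qed

text \<open>The new rest has some colour \<open>c\<close> by maximality. As the old rest contains no
  gadget, \<open>X\<close> takes at most \<open>d i + 1\<close> of its points. If the old rest has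
  at least \<open>d m + 3\<close> points, two of them survive and their edge gives
  \<open>b = c\<close>. Otherwise \<open>d m = 1\<close>, and a single survivor is possible only if
  the rest is a triple, the case treated separately.\<close>

lemma exchange_monochromatic:
  assumes U: "gadget_packing d P m U" and i: "i < m" and R: "monochromatic b (rest U)"
    and X: "X \<subseteq> U i \<union> rest U" "gadget (d i) X"
  shows "monochromatic b (rest (U(i := X)))"
proof -
  define R' where "R' = (U i \<union> rest U) - X"
  have R'_eq: "rest (U(i := X)) = R'" unfolding R'_def by (rule exchange(2)[OF U i X])
  obtain c where c: "monochromatic c R'"
    using rest_monochromatic[OF exchange(1)[OF U i X]] R'_eq by metis
  have fX: "finite X" using gadget_finite[OF X(2)] .
  have "\<not> X \<subseteq> rest U" using monochromatic_not_gadget[OF monochromatic_subset[OF R]] X(2) by blast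
  then have "X \<inter> rest U \<subset> X" by blast
  then have "card (X \<inter> rest U) < card X" using fX psubset_card_mono by blast
  then have small: "card (X \<inter> rest U) \<le> d i + 1" using gadget_card[OF X(2)] by simp
  have inter: "rest U - X = rest U \<inter> R'" unfolding R'_def by blast
  have card_inter: "card (rest U - X) = card (rest U) - card (X \<inter> rest U)"
    using card_Diff_subset_Int[of "rest U" X] finite_rest fX by (simp add: Int_commute)
  have "b = c"
  proof (cases "card (rest U - X) \<ge> 2")
    case True
    then obtain s t where st: "s \<in> rest U - X" "t \<in> rest U - X" "s \<noteq> t"
      using finite_rest card_le_Suc0_iff_eq[of "rest U - X"] by (metis finite_Diff not_less_eq_eq numeral_2_eq_2)
    then have "f {s, t} = b" using monochromaticD[OF R] by blast
    moreover have "f {s, t} = c" using monochromaticD[OF c] st inter by blast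
    ultimately show ?thesis by simp
  next
    case False
    then have "card (rest U) \<le> d i + 2" using card_inter small by linarith
    then have d1: "d m = 1" "card (rest U) \<le> 3" "d i = 1"
      using card_rest[OF U] sorted[OF i] d_pos[of i] i by linarith+
    have three: "card (rest U) = 3" using d1(2) card_rest_ge[OF U] by simp
    have two: "card (X \<inter> rest U) = 2" using False card_inter small three d1 by linarith
    have cardX: "card X = 3" and cardU: "card (U i) = 3"
      using gadget_card[OF X(2)] gadget_card[OF gadget_packingD(1)[OF U i]] d1 by simp_all
    have fU: "finite (U i)" using gadget_packing_finite[OF U i] .
    obtain y a where ya: "X \<inter> rest U = {y, a}" "y \<noteq> a" using two unfolding card_2_iff by blast
    have "card (rest U - X) = 1" using card_inter three two by simp
    then obtain r where r: "rest U - X = {r}" by (rule card_1_singletonE)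
    have "card (X - rest U) = card X - card (X \<inter> rest U)"
      using card_Diff_subset_Int[of X "rest U"] fX by simp
    then have "card (X - rest U) = 1" using cardX two by simp
    then obtain u where u: "X - rest U = {u}" by (rule card_1_singletonE)
    have Req: "rest U = {r, y, a}" "r \<noteq> y" "r \<noteq> a" using r ya(1) by blast+
    have Xeq: "X = {u, y, a}" "u \<noteq> y" "u \<noteq> a" using u ya(1) by blast+
    have uU: "u \<in> U i" using X(1) Xeq ya Req by auto
    have "card (U i - {u}) = 2" using cardU uU fU by simp
    then obtain u1 u2 where "U i - {u} = {u1, u2}" "u1 \<noteq> u2" unfolding card_2_iff by blast
    then have Ueq: "U i = {u, u1, u2}" "u \<noteq> u1" "u \<noteq> u2" "u1 \<noteq> u2" using uU by auto
    have "U i \<inter> rest U = {}" by (rule rest_disjoint[OF i])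
    then have dist: "distinct [r, y, a, u, u1, u2]" using Req Xeq Ueq ya(2) by auto
    show ?thesis
    proof (rule exchange_colour_triples[OF dist refl])
      fix T assume T: "T \<subseteq> {r, y, a, u, u1, u2}" "gadget 1 T"
      have W: "{r, y, a, u, u1, u2} = U i \<union> rest U" using Ueq Req by auto
      have T': "T \<subseteq> U i \<union> rest U" "gadget (d i) T" using T W d1 by auto
      obtain c where "monochromatic c (rest (U(i := T)))"
        using rest_monochromatic[OF exchange(1)[OF U i T']] by blast
      then show "\<exists>c. monochromatic c ({r, y, a, u, u1, u2} - T)"
        using exchange(2)[OF U i T'] W by auto
    next
      show "monochromatic b {r, y, a}" using R Req by simp
      show "gadget 1 {u, u1, u2}" using gadget_packingD(1)[OF U i] Ueq d1 by simp
      show "gadget 1 {u, y, a}" using X(2) Xeq d1 by simp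
      show "monochromatic c {r, u1, u2}"
        by (rule monochromatic_subset[OF c]) (use R'_def Ueq Xeq Req dist in auto)
    qed
  qed
  then show ?thesis using c R'_eq by simp
qed

text \<open>Suppose that they are disjoint. Removing \<open>e2\<close> from \<open>U i\<close> and
  the rest leaves a set \<open>Y\<close> of at least \<open>d i + 3\<close> points. A gadget in
  \<open>Y\<close> could replace \<open>U i\<close>, and then \<open>e2\<close> would lie in a rest
  of colour \<open>b\<close>. Without one, \<open>Y\<close> has a single colour; it contains
  \<open>e1\<close> and two points of the old rest, so \<open>e1\<close> would have colour
  \<open>b\<close>.\<close>

lemma off_edges_meet:
  assumes U: "gadget_packing d P m U" and i: "i < m" and R: "monochromatic b (rest U)"
    and e1: "e1 \<subseteq> U i \<union> rest U" "card e1 = 2" "f e1 \<noteq> b"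
    and e2: "e2 \<subseteq> U i \<union> rest U" "card e2 = 2" "f e2 \<noteq> b"
  shows "e1 \<inter> e2 \<noteq> {}"
proof
  assume disj: "e1 \<inter> e2 = {}"
  define Y where "Y = (U i \<union> rest U) - e2"
  obtain x1 y1 where xy1: "e1 = {x1, y1}" "x1 \<noteq> y1" using e1(2) unfolding card_2_iff by blast
  obtain x2 y2 where xy2: "e2 = {x2, y2}" "x2 \<noteq> y2" using e2(2) unfolding card_2_iff by blast
  have fU: "finite (U i)" using gadget_packing_finite[OF U i] .
  have fY: "finite Y" unfolding Y_def using fU finite_rest by simp
  have "card (U i \<union> rest U) = d i + 2 + card (rest U)"
    using card_Un_disjoint[OF fU finite_rest[of U] rest_disjoint[OF i, of U]] gadget_card[OF gadget_packingD(1)[OF U i]] by simp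
  moreover have "card Y = card (U i \<union> rest U) - 2"
    unfolding Y_def using e2 xy2 by (subst card_Diff_subset) auto
  ultimately have cardY: "card Y \<ge> d i + 3" using card_rest_ge[OF U] by linarith
  have "\<exists>X\<subseteq>Y. gadget (d i) X"
  proof (rule ccontr)
    assume "\<not> ?thesis"
    then obtain c where c: "monochromatic c Y"
      using monochromatic_if_no_gadget[OF fY, of "d i"] nonzero[of i] i cardY by (metis less_imp_le)
    have "f e1 = c" using c e1(1) disj xy1 unfolding Y_def by (auto intro: monochromaticD)
    moreover have "b = c"
    proof -
      have "\<not> e2 \<subseteq> rest U" using monochromaticD[OF R] xy2 e2(3) by blast
      then obtain w where w: "w \<in> e2" "w \<notin> rest U" by blast
      then obtain w' where w': "e2 = {w, w'}" using xy2 by blast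
      have "rest U - {w'} \<subseteq> Y" unfolding Y_def using w w' by blast
      have "card (rest U - {w'}) \<ge> card (rest U) - 1" by (simp add: card_Diff_singleton_if)
      then have "\<not> card (rest U - {w'}) \<le> Suc 0" using card_rest_ge[OF U] by linarith
      then obtain s t where st: "s \<in> rest U - {w'}" "t \<in> rest U - {w'}" "s \<noteq> t"
        using finite_rest card_le_Suc0_iff_eq[of "rest U - {w'}"] by blast
      have "f {s, t} = b" using monochromaticD[OF R] st by blast
      moreover have "f {s, t} = c" using monochromaticD[OF c] st \<open>rest U - {w'} \<subseteq> Y\<close> by blast
      ultimately show ?thesis by simp
    qed
    ultimately show False using e1(3) by simp
  qed
  then obtain X where X: "X \<subseteq> Y" "gadget (d i) X" by blast
  have XU: "X \<subseteq> U i \<union> rest U" using X(1) unfolding Y_def by blast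
  have "monochromatic b (U i \<union> rest U - X)"
    using exchange_monochromatic[OF U i R XU X(2)] exchange(2)[OF U i XU X(2)] by simp
  moreover have "x2 \<in> U i \<union> rest U - X" "y2 \<in> U i \<union> rest U - X"
    using e2(1) xy2 X(1) unfolding Y_def by auto
  ultimately have "f e2 = b" using monochromaticD xy2 by blast
  then show False using e2(3) by simp
qed

text \<open>Edges of other colours pairwise meet by \<open>off_edges_meet\<close>, which supplies
  the condition of \<open>gadget_from_edge\<close>. As \<open>u\<close> is outside the rest, at most
  \<open>w\<close> is lost from it, so at least \<open>d i + 1\<close> points remain.\<close>

lemma gadget_through_off_edge:
  assumes U: "gadget_packing d P m U" and i: "i < m" and R: "monochromatic b (rest U)"
    and uw: "u \<noteq> w" "{u, w} \<subseteq> U i \<union> rest U" "u \<in> U i" "f {u, w} \<noteq> b"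
  obtains D where "D \<subseteq> rest U - {u, w}" "gadget (d i) ({u, w} \<union> D)"
proof (rule gadget_from_edge[OF finite_rest R uw(1,4)])
  show "\<not> p dvd d i" using nonzero i by simp
  have "u \<notin> rest U" using uw(3) rest_disjoint[OF i] by blast
  then have "rest U - {u, w} = rest U - {w}" by blast
  then have "card (rest U - {u, w}) \<ge> card (rest U) - 1" by (simp add: card_Diff_singleton_if)
  then show "d i + 1 \<le> card (rest U - {u, w})"
    using card_rest[OF U] sorted[OF i] by linarith
  have "\<not> card (rest U) \<le> Suc 0" using card_rest_ge[OF U] by linarith
  then obtain s t where "s \<in> rest U" "t \<in> rest U" "s \<noteq> t"
    using finite_rest card_le_Suc0_iff_eq[of "rest U"] by blast
  then show "b \<in> {0..<int p}" using monochromaticD[OF R] range[of "{s, t}"] by metis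
  show "f {u, x} = b \<or> f {w, y} = b"
    if xy: "x \<in> rest U - {u, w}" "y \<in> rest U - {u, w}" "x \<noteq> y" for x y
  proof (rule ccontr)
    assume "\<not> ?thesis"
    then have "{u, x} \<inter> {w, y} \<noteq> {}"
      by (intro off_edges_meet[OF U i R]) (use xy uw in auto)
    then show False using xy uw(1) by auto
  qed
qed (rule that)

text \<open>Choose the packing with the most matching edges inside gadgets. Exchanging gadgets then shows that
  the matching avoids the rest and covers at most two vertices of each gadget.\<close>

lemma off_matching_small:
  assumes U0: "gadget_packing d P m U0" "monochromatic b (rest U0)" and M: "off_matching b P M"
  shows "card M \<le> m"
proof -
  define inside where "inside U = {e \<in> M. \<exists>i<m. e \<subseteq> U i}" for U
  define adm where "adm U \<longleftrightarrow> gadget_packing d P m U \<and> monochromatic b (rest U)" for U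
  have fM: "finite M" using off_matching_finite[OF M finite_P] .
  have inside_le: "card (inside U) < Suc (card M)" for U
    unfolding inside_def using fM by (simp add: card_mono less_Suc_eq_le)
  have "adm U0" unfolding adm_def using U0 by blast
  then obtain U where U: "adm U" and max: "\<And>V. adm V \<Longrightarrow> card (inside V) \<le> card (inside U)"
    using ex_has_greatest_nat[of adm U0 "\<lambda>U. card (inside U)" "Suc (card M)"] inside_le by blast
  have packing: "gadget_packing d P m U" and mono: "monochromatic b (rest U)"
    using U unfolding adm_def by auto
  have adm_exchange: "adm (V(i := X))"
    if "adm V" "i < m" "X \<subseteq> V i \<union> rest V" "gadget (d i) X" for V i X
    using that exchange(1)[of V i X] exchange_monochromatic[of V i b X] unfolding adm_def by simp
  have unique: "e = e'" if "adm V" "i < m" "e \<in> M" "e' \<in> M" "e \<subseteq> V i \<union> rest V" "e' \<subseteq> V i \<union> rest V" for V i e e'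
  proof (rule ccontr)
    assume "e \<noteq> e'"
    then have "e \<inter> e' = {}" by (rule off_matching_disjoint[OF M that(3,4)])
    moreover have "e \<inter> e' \<noteq> {}"
      using off_edges_meet[of V i b e e'] off_matching_edge(2,3)[OF M] that unfolding adm_def by simp
    ultimately show False by simp
  qed
  \<comment> \<open>Stated for every admissible \<open>V\<close> with at least as many inner edges
    as \<open>U\<close>, because it is applied to \<open>U\<close> and to an exchange of
    \<open>U\<close>. A gadget through \<open>e\<close> would enclose one more matching edge; none
    is lost, since by \<open>unique\<close> no second one lies in \<open>V i\<close> and the
    rest.\<close>
  have avoids_rest: "e \<inter> rest V = {}"
    if V: "adm V" and V_max: "card (inside U) \<le> card (inside V)" and e: "e \<in> M" for V e
  proof (rule ccontr)
    assume "e \<inter> rest V \<noteq> {}"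
    then obtain w where w: "w \<in> e" "w \<in> rest V" by blast
    have pV: "gadget_packing d P m V" and mV: "monochromatic b (rest V)" using V unfolding adm_def by auto
    obtain x y where "e = {x, y}" "x \<noteq> y" using off_matching_edge(2)[OF M e] unfolding card_2_iff by blast
    then obtain u where u: "e = {u, w}" "u \<noteq> w" using w(1) by (auto simp: insert_commute)
    have off: "f {u, w} \<noteq> b" using off_matching_edge(3)[OF M e] u by simp
    have "u \<notin> rest V" using monochromaticD[OF mV] off u w by blast
    moreover have "u \<in> P" using off_matching_edge(1)[OF M e] u by blast
    ultimately obtain i where i: "i < m" "u \<in> V i" unfolding rest_def by blast
    have eV: "e \<subseteq> V i \<union> rest V" using u i w by blast
    obtain D where D: "D \<subseteq> rest V - {u, w}" "gadget (d i) ({u, w} \<union> D)"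
      using gadget_through_off_edge[OF pV i(1) mV u(2) _ i(2) off] eV u(1) by blast
    define V' where "V' = V(i := {u, w} \<union> D)"
    have V': "adm V'" unfolding V'_def by (rule adm_exchange[OF V i(1) _ D(2)]) (use D(1) eV u(1) in blast)
    have "e \<in> inside V'" unfolding inside_def V'_def using e u(1) i(1) by auto
    moreover have "e \<notin> inside V"
    proof
      assume "e \<in> inside V"
      then obtain j where "j < m" "w \<in> V j" unfolding inside_def using w by blast
      then show False using rest_disjoint[of j V] w by blast
    qed
    moreover have "inside V \<subseteq> inside V'"
    proof
      fix g assume g: "g \<in> inside V"
      then obtain j where j: "j < m" "g \<subseteq> V j" "g \<in> M" unfolding inside_def by blast
      have "j \<noteq> i"
      proof
        assume "j = i"
        then have "g = e" using unique[OF V i(1) j(3) e _ eV] j(2) by blast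
        then show False using g \<open>e \<notin> inside V\<close> by simp
      qed
      then show "g \<in> inside V'" unfolding inside_def V'_def using j by auto
    qed
    moreover have "finite (inside V')" unfolding inside_def using fM by simp
    ultimately have "card (inside V) < card (inside V')" by (metis psubsetI psubset_card_mono)
    then show False using max[OF V'] V_max by linarith
  qed
  \<comment> \<open>If \<open>M\<close> covered a third point \<open>a\<close> of
    \<open>U i\<close>, a gadget through an edge of \<open>U i\<close> off \<open>a\<close> would
    push \<open>a\<close> into the rest while keeping all inner edges, against
    \<open>avoids_rest\<close>.\<close>
  have two: "card (\<Union>M \<inter> U i) \<le> 2" if i: "i < m" for i
  proof (rule ccontr)
    assume many: "\<not> ?thesis"
    \<comment> \<open>A matching edge inside \<open>U i\<close> is unique and must survive the
      exchange, so it is taken if it exists. Otherwise any edge of \<open>U i\<close> of another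
      colour will do; one exists because a gadget is not monochromatic.\<close>
    obtain g where g: "g \<subseteq> U i" "card g = 2" "f g \<noteq> b" "\<And>e. e \<in> M \<Longrightarrow> e \<subseteq> U i \<Longrightarrow> e = g"
    proof (cases "\<exists>e\<in>M. e \<subseteq> U i")
      case True
      then obtain e where e: "e \<in> M" "e \<subseteq> U i" by blast
      have "e' = e" if "e' \<in> M" "e' \<subseteq> U i" for e' 
        by (rule unique[OF U i that(1) e(1)]) (use that(2) e(2) in auto)
      then show thesis using that[OF e(2) off_matching_edge(2,3)[OF M e(1)]] by simp
    next
      case False
      have "\<not> monochromatic b (U i)" using monochromatic_not_gadget gadget_packingD(1)[OF packing i] by blast
      then obtain u w where "u \<in> U i" "w \<in> U i" "u \<noteq> w" "f {u, w} \<noteq> b"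
        unfolding monochromatic_def by blast
      then show thesis using that[of "{u, w}"] False by simp
    qed
    obtain u w where gw: "g = {u, w}" "u \<noteq> w" using g(2) unfolding card_2_iff by blast
    note uw = gw(2) g(1,3,4)[unfolded gw(1)]
    have "\<not> \<Union>M \<inter> U i \<subseteq> {u, w}"
    proof
      assume "\<Union>M \<inter> U i \<subseteq> {u, w}"
      then have "card (\<Union>M \<inter> U i) \<le> card {u, w}" by (intro card_mono) auto
      then show False using many uw(1) by simp
    qed
    then obtain a e where a: "a \<in> U i" "a \<notin> {u, w}" "a \<in> e" "e \<in> M" by blast
    obtain D where D: "D \<subseteq> rest U - {u, w}" "gadget (d i) ({u, w} \<union> D)"
      using gadget_through_off_edge[OF packing i mono uw(1) _ _ uw(3)] uw(2) by blast
    define V where "V = U(i := {u, w} \<union> D)"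
    have X: "{u, w} \<union> D \<subseteq> U i \<union> rest U" using D(1) uw(2) by blast
    have V: "adm V" unfolding V_def by (rule adm_exchange[OF U i X D(2)])
    have "inside U \<subseteq> inside V"
    proof
      fix g assume "g \<in> inside U"
      then obtain j where j: "j < m" "g \<subseteq> U j" "g \<in> M" unfolding inside_def by blast
      show "g \<in> inside V"
      proof (cases "j = i")
        case True
        then have "g = {u, w}" using uw(4) j by blast
        then have "g \<subseteq> V i" unfolding V_def by auto
        then show ?thesis unfolding inside_def using i j(3) by blast
      next
        case False
        then have "g \<subseteq> V j" unfolding V_def using j by simp
        then show ?thesis unfolding inside_def using j by blast
      qed
    qed
    then have "card (inside U) \<le> card (inside V)"
      unfolding inside_def using fM by (intro card_mono) auto
    then have "e \<inter> rest V = {}" using avoids_rest[OF V _ a(4)] by blast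
    moreover have "a \<in> rest V"
      unfolding V_def exchange(2)[OF packing i X D(2)] using a D(1) rest_disjoint[OF i, of U] by blast
    ultimately show False using a(3) by blast
  qed
  have "\<Union>M \<subseteq> (\<Union>i<m. \<Union>M \<inter> U i)"
  proof
    fix v assume "v \<in> \<Union>M"
    then obtain e where e: "v \<in> e" "e \<in> M" by blast
    have "v \<notin> rest U" using avoids_rest[OF U order.refl e(2)] e(1) by blast
    moreover have "v \<in> P" using off_matching_edge(1)[OF M e(2)] e(1) by blast
    ultimately show "v \<in> (\<Union>i<m. \<Union>M \<inter> U i)" unfolding rest_def using e by blast
  qed
  moreover have "finite (\<Union>i<m. \<Union>M \<inter> U i)"
    using gadget_packing_finite[OF packing] by auto
  ultimately have "card (\<Union>M) \<le> card (\<Union>i<m. \<Union>M \<inter> U i)" by (rule card_mono[rotated])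
  also have "\<dots> \<le> (\<Sum>i<m. card (\<Union>M \<inter> U i))" by (rule card_UN_le) simp
  also have "\<dots> \<le> (\<Sum>i<m. 2)" by (rule sum_mono) (use two in simp)
  finally have "2 * card M \<le> 2 * m" using card_off_matching_vertices[OF M finite_P] by simp
  then show ?thesis by simp
qed

end

section \<open>The Ramsey number\<close>

context residue_colouring
begin

text \<open>All gadgets together need at most \<open>card P\<close> points, so a packing that stops
  after \<open>m\<close> gadgets leaves at least \<open>d m + 2\<close>. The assumption
  \<open>spare\<close> provides one more point, or all degrees are one and three points are enough.
  Sorting by degree makes a rest large enough for \<open>d m\<close> large enough for every
  exchange.\<close>

lemma zero_sum_embedding_tight:
  assumes G: "simple_graph V E" and dvd: "p dvd card E"
    and S: "two_packing V E S" "card S = p - 1"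
    and deg: "\<And>v. v \<in> S \<Longrightarrow> \<not> p dvd vertex_degree E v"
    and P: "finite P" "card P \<ge> card V + p - 1"
    and spare: "card P > (\<Sum>v\<in>S. vertex_degree E v + 2) \<or> (\<forall>v\<in>S. vertex_degree E v = 1)"
  shows "zero_sum_embedding V E P"
proof -
  have p0: "p \<ge> 1" using prime_gt_0_nat[OF prime_p] by simp
  have fV: "finite V" using G unfolding simple_graph_def by blast
  have fS: "finite S" using two_packing_subset[OF S(1)] fV finite_subset by blast
  obtain xs0 where xs0: "set xs0 = S" "distinct xs0" using finite_distinct_list[OF fS] by blast
  define xs where "xs = sort_key (vertex_degree E) xs0"
  have xs: "set xs = S" "distinct xs" "sorted (map (vertex_degree E) xs)"
    unfolding xs_def using xs0 by auto
  have len: "length xs = p - 1" using xs S(2) distinct_card[of xs] by simp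
  define d where "d i = vertex_degree E (xs ! i)" for i
  have xsS: "xs ! i \<in> S" if "i < p - 1" for i using that len xs(1) nth_mem by metis
  have bij: "bij_betw ((!) xs) {..<p - 1} S" using bij_betw_nth[OF xs(2), of "{..<p - 1}" S] len xs(1) by simp
  have sum_d: "(\<Sum>i<p - 1. d i + 2) = (\<Sum>v\<in>S. vertex_degree E v + 2)"
    unfolding d_def by (rule sum.reindex_bij_betw[OF bij])
  have "(\<Sum>v\<in>S. vertex_degree E v + 2) = (\<Sum>v\<in>S. (vertex_degree E v + 1) + 1)" by simp
  also have "\<dots> = card (\<Union>v\<in>S. closed_nbhd E v) + card S"
    unfolding card_packing_union[OF G S(1) order.refl] by (simp only: sum.distrib) simp
  also have "\<dots> \<le> card V + (p - 1)"
    using packing_union_subset[OF G S(1)] fV S(2) by (simp add: card_mono)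
  finally have enough: "(\<Sum>i<p - 1. d i + 2) \<le> card P" using sum_d P(2) p0 by linarith
  show ?thesis
  proof (cases "\<exists>U. gadget_packing d P (p - 1) U")
    case True
    then obtain U where U: "gadget_packing d P (p - 1) U" by blast
    define idx where "idx = the_inv_into {..<p - 1} ((!) xs)"
    have idx: "idx v < p - 1" "xs ! idx v = v" if "v \<in> S" for v
    proof -
      show "xs ! idx v = v" unfolding idx_def using f_the_inv_into_f_bij_betw[OF bij] that by blast
      have "idx v \<in> {..<p - 1}" unfolding idx_def
        by (rule the_inv_into_into) (use bij that in \<open>auto simp: bij_betw_def\<close>)
      then show "idx v < p - 1" by simp
    qed
    show ?thesis
    proof (rule zero_sum_embedding_gadgets[OF G S P])
      fix v assume v: "v \<in> S"
      show "gadget (vertex_degree E v) (U (idx v))"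
        using gadget_packingD(1)[OF U idx(1)[OF v]] idx(2)[OF v] unfolding d_def by simp
      show "U (idx v) \<subseteq> P" using gadget_packingD(2)[OF U idx(1)[OF v]] .
    next
      fix u v assume uv: "u \<in> S" "v \<in> S" "u \<noteq> v"
      then have "idx u \<noteq> idx v" using idx(2) by metis
      then show "U (idx u) \<inter> U (idx v) = {}" using gadget_packingD(3)[OF U] idx(1) uv by blast
    qed
  next
    case False
    define good where "good m \<longleftrightarrow> m < p - 1 \<and> (\<exists>U. gadget_packing d P m U)" for m
    have empty: "gadget_packing d P 0 U" for U unfolding gadget_packing_def by simp
    then have "0 < p - 1" using False by (metis not_gr_zero)
    then have "good 0" unfolding good_def using empty by blast
    then obtain m where m: "good m" and max: "\<And>k. good k \<Longrightarrow> k \<le> m"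
      using ex_has_greatest_nat[of good 0 "\<lambda>k. k" "p - 1"] unfolding good_def by blast
    obtain U where U: "gadget_packing d P m U" and mp: "m < p - 1" using m unfolding good_def by blast
    have none: "\<not> gadget_packing d P (Suc m) V" for V
    proof
      assume V: "gadget_packing d P (Suc m) V"
      then have "Suc m \<noteq> p - 1" using False by metis
      then have "good (Suc m)" unfolding good_def using V mp by auto
      then show False using max by fastforce
    qed
    have split: "(\<Sum>i<p - 1. d i + 2) \<ge> (\<Sum>i<m. d i + 2) + (d m + 2)"
    proof -
      have "(\<Sum>i<Suc m. d i + 2) \<le> (\<Sum>i<p - 1. d i + 2)" by (rule sum_mono2) (use mp in auto)
      then show ?thesis by simp
    qed
    interpret maximal_packing p f P d m
    proof unfold_locales
      show "finite P" by (rule P(1))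
      show "d i \<le> d m" if "i < m" for i
        using sorted_nth_mono[OF xs(3), of i m] that mp len unfolding d_def by simp
      show "\<not> p dvd d i" if "i \<le> m" for i using deg xsS[of i] that mp unfolding d_def by simp
      show "(\<Sum>i<m. d i + 2) + d m + 3 \<le> card P \<or> d m = 1 \<and> (\<Sum>i<m. d i + 2) + 3 \<le> card P"
      proof (cases "\<forall>v\<in>S. vertex_degree E v = 1")
        case True
        then have "d m = 1" using xsS[OF mp] unfolding d_def by blast
        then show ?thesis using split enough by linarith
      next
        case False
        then have "card P > (\<Sum>i<p - 1. d i + 2)" using spare unfolding sum_d by blast
        then show ?thesis using split by linarith
      qed
    qed (rule none)
    obtain b where b: "monochromatic b (rest U)" using rest_monochromatic[OF U] .
    show ?thesis
      by (rule zero_sum_embedding_small_matchings[OF G dvd S P, of b])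
        (use off_matching_small[OF U b] mp in fastforce)
  qed
qed

end

lemma forces_zero_sum_copyI:
  assumes p: "prime p" and G: "simple_graph V E"
    and embed: "\<And>f :: nat set \<Rightarrow> int. residue_colouring p f \<Longrightarrow>
      residue_colouring.zero_sum_embedding p f V E {..<N}"
  shows "forces_zero_sum_copy V E p N"
  unfolding forces_zero_sum_copy_def
proof (intro allI impI)
  fix f :: "nat set \<Rightarrow> int" assume "f \<in> [{..<N}]\<^bsup>2\<^esup> \<rightarrow> {0..<int p}"
  \<comment> \<open>The given colouring is bounded on edges of the host only. Reduction modulo
    \<open>p\<close> bounds it on all sets, as the locale demands, and preserves every sum modulo
    \<open>p\<close>.\<close>
  define f' where "f' e = f e mod int p" for e
  have rc: "residue_colouring p f'"
    by unfold_locales (use p prime_gt_0_nat[OF p] in \<open>auto simp: f'_def\<close>)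
  obtain \<phi> where \<phi>: "inj_on \<phi> V" "\<phi> ` V \<subseteq> {..<N}" "[(\<Sum>e\<in>E. f' (\<phi> ` e)) = 0] (mod int p)"
    using embed[OF rc] unfolding residue_colouring.zero_sum_embedding_def[OF rc] by blast
  have "inj_on ((`) \<phi>) E"
    by (rule inj_on_subset[OF inj_on_image_Pow[OF \<phi>(1)]])
      (use G in \<open>auto simp: simple_graph_def nsets_def\<close>)
  then have "(\<Sum>e\<in>(\<lambda>e. \<phi> ` e) ` E. f e) = (\<Sum>e\<in>E. f (\<phi> ` e))" by (simp add: sum.reindex)
  also have "[\<dots> = (\<Sum>e\<in>E. f' (\<phi> ` e))] (mod int p)"
    by (rule cong_sum) (simp add: f'_def cong_def)
  also note \<phi>(3)
  finally have "[(\<Sum>e\<in>(\<lambda>e. \<phi> ` e) ` E. f e) = 0] (mod int p)" .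
  moreover have "copy_edges V E N ((\<lambda>e. \<phi> ` e) ` E)" unfolding copy_edges_def using \<phi> by blast
  ultimately show "\<exists>E'. copy_edges V E N E' \<and> [(\<Sum>e\<in>E'. f e) = 0] (mod int p)" by blast
qed

text \<open>Colour an edge by the number of its ends among the vertices \<open>\<ge> n - 1\<close>, modulo \<open>p\<close>. A copy of an
  \<open>n\<close>-vertex graph contains between \<open>1\<close> and \<open>p - 1\<close> of these vertices, each contributing \<open>d\<close>.\<close>

lemma not_forces_zero_sum_copy_if_regular:
  fixes d :: int
  assumes p: "prime p" and G: "simple_graph V E" and V: "V \<noteq> {}"
    and d: "\<not> [d = 0] (mod int p)" "\<And>v. v \<in> V \<Longrightarrow> [int (vertex_degree E v) = d] (mod int p)"
    and N: "N < card V + p - 1"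
  shows "\<not> forces_zero_sum_copy V E p N"
proof
  assume force: "forces_zero_sum_copy V E p N"
  have fV: "finite V" using G unfolding simple_graph_def by blast
  have n0: "card V > 0" using V fV by (simp add: card_gt_0_iff)
  have p0: "int p > 0" using prime_gt_0_nat[OF p] by simp
  define h :: "nat \<Rightarrow> int" where "h x = (if x < card V - 1 then 0 else 1)" for x
  define f where "f e = (\<Sum>x\<in>e. h x) mod int p" for e
  have "f \<in> [{..<N}]\<^bsup>2\<^esup> \<rightarrow> {0..<int p}" unfolding f_def using p0 by auto
  then obtain E' where E': "copy_edges V E N E'" "[(\<Sum>e\<in>E'. f e) = 0] (mod int p)"
    using force unfolding forces_zero_sum_copy_def by blast
  then obtain \<phi> where \<phi>: "inj_on \<phi> V" "\<phi> ` V \<subseteq> {..<N}" "E' = (\<lambda>e. \<phi> ` e) ` E"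
    unfolding copy_edges_def by blast
  have sub: "e \<subseteq> V" if "e \<in> E" for e using G that unfolding simple_graph_def nsets_def by auto
  have "inj_on ((`) \<phi>) E"
    by (rule inj_on_subset[OF inj_on_image_Pow[OF \<phi>(1)]]) (use sub in auto)
  then have "(\<Sum>e\<in>E'. f e) = (\<Sum>e\<in>E. f (\<phi> ` e))" unfolding \<phi>(3) by (simp add: sum.reindex)
  also have "[\<dots> = (\<Sum>e\<in>E. \<Sum>v\<in>e. h (\<phi> v))] (mod int p)"
  proof (rule cong_sum)
    fix e assume "e \<in> E"
    then have "inj_on \<phi> e" using \<phi>(1) sub inj_on_subset by blast
    then show "[f (\<phi> ` e) = (\<Sum>v\<in>e. h (\<phi> v))] (mod int p)"
      unfolding f_def by (simp add: sum.reindex cong_def)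
  qed
  also have "(\<Sum>e\<in>E. \<Sum>v\<in>e. h (\<phi> v)) = (\<Sum>v\<in>V. int (vertex_degree E v) * h (\<phi> v))"
    by (rule sum_edges_vertex_sums[OF G])
  also have "[\<dots> = (\<Sum>v\<in>V. d * h (\<phi> v))] (mod int p)"
    by (intro cong_sum cong_mult cong_refl d(2))
  also have "(\<Sum>v\<in>V. d * h (\<phi> v)) = d * (\<Sum>x\<in>\<phi> ` V. h x)"
    using \<phi>(1) by (simp add: sum.reindex sum_distrib_left)
  also have "(\<Sum>x\<in>\<phi> ` V. h x) = (\<Sum>x\<in>{x \<in> \<phi> ` V. \<not> x < card V - 1}. 1)"
    unfolding h_def by (subst sum.inter_filter) (use fV in \<open>auto intro: sum.cong\<close>)
  also have "\<dots> = int (card {x \<in> \<phi> ` V. \<not> x < card V - 1})" by simp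
  finally have "[(\<Sum>e\<in>E'. f e) = d * int (card {x \<in> \<phi> ` V. \<not> x < card V - 1})] (mod int p)" .
  then have "[d * int (card {x \<in> \<phi> ` V. \<not> x < card V - 1}) = 0] (mod int p)"
    using E'(2) cong_trans cong_sym by blast
  then have "int p dvd d * int (card {x \<in> \<phi> ` V. \<not> x < card V - 1})" by (simp add: cong_0_iff)
  then have dvd: "p dvd card {x \<in> \<phi> ` V. \<not> x < card V - 1}"
    using d(1) p by (auto simp: cong_0_iff prime_dvd_mult_iff)
  have "{x \<in> \<phi> ` V. \<not> x < card V - 1} \<subseteq> {card V - 1..<N}" using \<phi>(2) by auto
  then have "card {x \<in> \<phi> ` V. \<not> x < card V - 1} \<le> N - (card V - 1)"
    using card_mono[of "{card V - 1..<N}"] by fastforce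
  then have "card {x \<in> \<phi> ` V. \<not> x < card V - 1} < p" using N n0 prime_gt_0_nat[OF p] by linarith
  moreover have "card {x \<in> \<phi> ` V. \<not> x < card V - 1} \<noteq> 0"
  proof
    assume "card {x \<in> \<phi> ` V. \<not> x < card V - 1} = 0"
    then have "\<phi> ` V \<subseteq> {..<card V - 1}" using fV by auto
    then have "card (\<phi> ` V) \<le> card V - 1" using card_mono[of "{..<card V - 1}"] by fastforce
    then show False using \<phi>(1) n0 by (simp add: card_image)
  qed
  ultimately show False using dvd by (auto dest: dvd_imp_le)
qed

theorem theorem1p1:
  fixes V :: "'a set" and E :: "'a set set" and S :: "'a set" and p n s\<^sub>0 c :: nat
  assumes "prime p"
    and "simple_graph V E"
    and "n = card V"
    and "p dvd card E"
    and "min_degree V E \<ge> 1"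
    and "two_packing V E S"
    and "card S = p - 1"
    and "s\<^sub>0 = card {v \<in> S. [vertex_degree E v = 0] (mod p)}"
    and "c = (if V \<noteq> (\<Union>v\<in>S. closed_nbhd E v) \<or> (\<forall>v\<in>S. vertex_degree E v = 1) then 0 else 1)"
  shows "zero_sum_ramsey V E p \<le>
           (if s\<^sub>0 = 0 then enat (n + p - 1 + c) else enat (n + 5 * p - 9 + s\<^sub>0 + c))
       \<and> (s\<^sub>0 = 0 \<and> c = 0
           \<and> (\<exists>d::int. \<not> [d = 0] (mod int p) \<and> (\<forall>v\<in>V. [int (vertex_degree E v) = d] (mod int p)))
           \<longrightarrow> zero_sum_ramsey V E p = enat (n + p - 1))"
proof -
  note p = assms(1) and G = assms(2) and S = assms(6,7)
  have p2: "p \<ge> 2" using p by (rule prime_ge_2_nat)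
  have fV: "finite V" using G unfolding simple_graph_def by blast
  have SV: "S \<subseteq> V" using two_packing_subset[OF S(1)] .
  have fS: "finite S" using SV fV finite_subset by blast
  have "S \<noteq> {}" using S(2) p2 by auto
  then have Vne: "V \<noteq> {}" using SV by blast
  have deg: "vertex_degree E v \<ge> 1" if "v \<in> V" for v
    using assms(5) fV that Vne unfolding min_degree_def by simp
  have upper: "zero_sum_ramsey V E p \<le> enat N" if "forces_zero_sum_copy V E p N" for N
    unfolding zero_sum_ramsey_def using that by (intro Inf_lower) blast
  have forces0: "forces_zero_sum_copy V E p (n + p - 1 + c)" if s0: "s\<^sub>0 = 0"
  proof (rule forces_zero_sum_copyI[OF p G])
    fix f :: "nat set \<Rightarrow> int" assume rc: "residue_colouring p f"
    have nz: "\<not> p dvd vertex_degree E v" if "v \<in> S" for v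
      using s0 assms(8) fS that by (auto simp: cong_0_iff)
    have "(\<Sum>v\<in>S. vertex_degree E v + 2) = (\<Sum>v\<in>S. (vertex_degree E v + 1) + 1)" by simp
    also have "\<dots> = card (\<Union>v\<in>S. closed_nbhd E v) + (p - 1)"
      unfolding card_packing_union[OF G S(1) order.refl] S(2)[symmetric] by (simp only: sum.distrib) simp
    finally have total: "(\<Sum>v\<in>S. vertex_degree E v + 2) = card (\<Union>v\<in>S. closed_nbhd E v) + (p - 1)" .
    have sub: "(\<Union>v\<in>S. closed_nbhd E v) \<subseteq> V" by (rule packing_union_subset[OF G S(1)])
    \<comment> \<open>The left-over point comes from a vertex that \<open>S\<close> does not
      dominate, or else from \<open>c = 1\<close>; in the remaining case all degrees in
      \<open>S\<close> are one.\<close>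
    have spare: "n + p - 1 + c > (\<Sum>v\<in>S. vertex_degree E v + 2) \<or> (\<forall>v\<in>S. vertex_degree E v = 1)"
    proof (cases "V = (\<Union>v\<in>S. closed_nbhd E v)")
      case True
      then have "card (\<Union>v\<in>S. closed_nbhd E v) = n" using assms(3) by simp
      moreover have "c = 1 \<or> (\<forall>v\<in>S. vertex_degree E v = 1)" using assms(9) True by auto
      ultimately show ?thesis using total p2 by linarith
    next
      case False
      then have "card (\<Union>v\<in>S. closed_nbhd E v) < n"
        using sub fV assms(3) by (simp add: psubsetI psubset_card_mono)
      then show ?thesis using total p2 by linarith
    qed
    show "residue_colouring.zero_sum_embedding p f V E {..<n + p - 1 + c}"
      by (rule residue_colouring.zero_sum_embedding_tight[OF rc G assms(4) S nz])
        (use spare assms(3) in simp_all)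
  qed
  have forces1: "forces_zero_sum_copy V E p (n + 5 * p - 9 + s\<^sub>0 + c)" if s0: "s\<^sub>0 \<noteq> 0"
  proof (rule forces_zero_sum_copyI[OF p G])
    fix f :: "nat set \<Rightarrow> int" assume rc: "residue_colouring p f"
    \<comment> \<open>Since \<open>s\<^sub>0\<close> is at least one, it supplies the step from
      \<open>- 9\<close> to \<open>- 8\<close>.\<close>
    have "card V + 5 * p - 8 \<le> card {..<n + 5 * p - 9 + s\<^sub>0 + c}" using s0 p2 assms(3) by simp
    then show "residue_colouring.zero_sum_embedding p f V E {..<n + 5 * p - 9 + s\<^sub>0 + c}"
      using residue_colouring.zero_sum_embedding_large[OF rc G assms(4) S] deg SV by blast
  qed
  have lower: "zero_sum_ramsey V E p = enat (n + p - 1)"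
    if "s\<^sub>0 = 0" "c = 0" "\<not> [d = 0] (mod int p)" "\<forall>v\<in>V. [int (vertex_degree E v) = d] (mod int p)" for d :: int
  proof (rule antisym)
    show "zero_sum_ramsey V E p \<le> enat (n + p - 1)" using upper[OF forces0] that by simp
    show "enat (n + p - 1) \<le> zero_sum_ramsey V E p"
      unfolding zero_sum_ramsey_def
    proof (rule Inf_greatest)
      fix x assume "x \<in> enat ` {N. forces_zero_sum_copy V E p N}"
      then obtain N where N: "x = enat N" "forces_zero_sum_copy V E p N" by blast
      then have "\<not> N < card V + p - 1"
        using not_forces_zero_sum_copy_if_regular[OF p G Vne that(3)] that(4) by blast
      then show "enat (n + p - 1) \<le> x" using N(1) assms(3) by simp
    qed
  qed
  have "zero_sum_ramsey V E p \<le>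
      (if s\<^sub>0 = 0 then enat (n + p - 1 + c) else enat (n + 5 * p - 9 + s\<^sub>0 + c))"
    using upper[OF forces0] upper[OF forces1] by simp
  then show ?thesis using lower by blast
qed

end
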